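(* There are $\varepsilon>0$ and a constant $C$ (independent of $n$) such that $\sum N(\bar w,\bar l)/N_0< C\cdot 3^{(1-\gamma)n}$, where the sum is over all $\bar w=(w_0,w_1,w_2)$ of nonnegative integers with $\sum w_i=n$ and $\bar l=(l_0,l_1,l_2)$ of nonnegative integers with $\sum l_i=km$ such that both $(w_1/n,w_2/n)$ and $(l_1/(km),l_2/(km))$ lie in $\mathcal U_\varepsilon(1/3,1/3)$.
   Context: Fix an integer $k\ge3$ and a real $\gamma$ bounded above by a constant $<1$ with $k\gamma>2$; let $m=\gamma n$ (asymptotics as $n\to\infty$). Let $M(m,n)=\sum_{v_1,\dots,v_n\ge 2}\binom{m}{v_1,\dots,v_n}$ (sum over integers $v_i\ge 2$ with $\sum v_i=m$), $N_0=M(km,n)$. For $\bar l$ let $K(\bar l)=\sum \prod_{j=1}^m\binom{k}{k_{0,j},k_{1,j},k_{2,j}}$ over all $3\times m$ matrices of nonnegative integers with every column summing to $k$, row $i$ summing to $l_i$, and $k_{1,j}\equiv k_{2,j}\pmod 3$ for all $j$. Define $N(\bar w,\bar l)=\binom{n}{w_0,w_1,w_2}K(\bar l)\prod_{i=0}^2M(l_i,w_i)$. For reals $a,b$, $\mathcal U_\varepsilon(a,b)=\{(c,d):|c-a|<\varepsilon,|d-b|<\varepsilon\}$. *)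

theory Defs
  imports "HOL-Analysis.Analysis" "HOL-Number_Theory.Number_Theory"
begin

text \<open>
  The multinomial coefficient with top entry \<open>\<Sum>i\<in>I. v i\<close> and bottom entries \<open>v i\<close>, \<open>i \<in> I\<close>.
  It is real-valued, so \<open>/\<close> is exact; the top entry is implicit because every use below
  constrains the sum of the bottom entries.
\<close>

definition multinom :: "'i set \<Rightarrow> ('i \<Rightarrow> nat) \<Rightarrow> real" where
  "multinom I v = fact (\<Sum>i\<in>I. v i) / (\<Prod>i\<in>I. fact (v i))"

text \<open>Vectors are functions extended by \<open>undefined\<close> outside their index set, so that each
  vector is counted exactly once.\<close>

definition occupancies :: "nat \<Rightarrow> nat \<Rightarrow> (nat \<Rightarrow> nat) set" where
  "occupancies m n = {v \<in> {..<n} \<rightarrow>\<^sub>E {2..}. (\<Sum>i<n. v i) = m}"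

definition M :: "nat \<Rightarrow> nat \<Rightarrow> real" where
  "M m n = (\<Sum>v\<in>occupancies m n. multinom {..<n} v)"

text \<open>\<open>compositions3 s\<close> is the set of triples of natural numbers with sum \<open>s\<close>, indexed by 0, 1, 2.\<close>

definition compositions3 :: "nat \<Rightarrow> (nat \<Rightarrow> nat) set" where
  "compositions3 s = {v \<in> {..<3} \<rightarrow>\<^sub>E UNIV. (\<Sum>i<3. v i) = s}"

text \<open>A \<open>3 \<times> m\<close> matrix is the family \<open>\<kappa>\<close> of its columns: \<open>\<kappa> j i\<close> is the entry in row \<open>i\<close>, column \<open>j\<close>.\<close>

definition matrices :: "nat \<Rightarrow> nat \<Rightarrow> (nat \<Rightarrow> nat) \<Rightarrow> (nat \<Rightarrow> nat \<Rightarrow> nat) set" where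
  "matrices k m l = {\<kappa> \<in> {..<m} \<rightarrow>\<^sub>E compositions3 k.
     (\<forall>i<3. (\<Sum>j<m. \<kappa> j i) = l i) \<and> (\<forall>j<m. [\<kappa> j 1 = \<kappa> j 2] (mod 3))}"

definition K :: "nat \<Rightarrow> nat \<Rightarrow> (nat \<Rightarrow> nat) \<Rightarrow> real" where
  "K k m l = (\<Sum>\<kappa>\<in>matrices k m l. \<Prod>j<m. multinom {..<3} (\<kappa> j))"

text \<open>The number \<open>n\<close> is implicit in \<open>N\<close>: it is the sum of the entries of \<open>w\<close>.\<close>

definition N :: "nat \<Rightarrow> nat \<Rightarrow> (nat \<Rightarrow> nat) \<Rightarrow> (nat \<Rightarrow> nat) \<Rightarrow> real" where
  "N k m w l = multinom {..<3} w * K k m l * (\<Prod>i<3. M (l i) (w i))"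

definition N0 :: "nat \<Rightarrow> nat \<Rightarrow> nat \<Rightarrow> real" where
  "N0 k m n = M (k * m) n"

definition U :: "real \<Rightarrow> real \<Rightarrow> real \<Rightarrow> (real \<times> real) set" where
  "U \<epsilon> a b = {(c, d). \<bar>c - a\<bar> < \<epsilon> \<and> \<bar>d - b\<bar> < \<epsilon>}"

definition central :: "nat \<Rightarrow> nat \<Rightarrow> nat \<Rightarrow> real \<Rightarrow> ((nat \<Rightarrow> nat) \<times> (nat \<Rightarrow> nat)) set" where
  "central k m n \<epsilon> = {(w, l). w \<in> compositions3 n \<and> l \<in> compositions3 (k * m) \<and>
     (real (w 1) / real n, real (w 2) / real n) \<in> U \<epsilon> (1/3) (1/3) \<and>
     (real (l 1) / real (k * m), real (l 2) / real (k * m)) \<in> U \<epsilon> (1/3) (1/3)}"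

text \<open>All index sets are finite, so none of the sums above is zero by convention.\<close>

lemma finite_PiE_sum_eq:
  assumes "finite I"
  shows "finite {v \<in> I \<rightarrow>\<^sub>E A. (\<Sum>i\<in>I. v i) = (s :: nat)}"
proof (rule finite_subset)
  show "{v \<in> I \<rightarrow>\<^sub>E A. (\<Sum>i\<in>I. v i) = s} \<subseteq> I \<rightarrow>\<^sub>E {..s}"
    using assms by (auto simp: PiE_def intro: member_le_sum)
  show "finite (I \<rightarrow>\<^sub>E {..s})"
    using assms by (intro finite_PiE) auto
qed

lemma finite_occupancies: "finite (occupancies m n)"
  unfolding occupancies_def by (rule finite_PiE_sum_eq) simp

lemma finite_compositions3: "finite (compositions3 s)"
  unfolding compositions3_def by (rule finite_PiE_sum_eq) simp

lemma finite_matrices: "finite (matrices k m l)"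
proof (rule finite_subset)
  show "matrices k m l \<subseteq> {..<m} \<rightarrow>\<^sub>E compositions3 k"
    by (auto simp: matrices_def)
  show "finite ({..<m} \<rightarrow>\<^sub>E compositions3 k)"
    by (intro finite_PiE finite_compositions3) simp
qed

lemma finite_central: "finite (central k m n \<epsilon>)"
  by (rule finite_subset[of _ "compositions3 n \<times> compositions3 (k * m)"])
     (auto simp: central_def finite_compositions3)

end

theory Submission
  imports Defs "HOL-Computational_Algebra.Formal_Power_Series"
begin

text \<open>
  Write \<open>s = k m\<close>. Up to the factor \<open>K(l) / multinom(l)\<close>, the number \<open>N(w, l)\<close> counts the ways to
  throw \<open>s\<close> balls into \<open>n\<close> boxes, each receiving at least two, and to colour the boxes with three
  colours such that \<open>w i\<close> boxes and \<open>l i\<close> balls have colour \<open>i\<close>. Summed over all \<open>w\<close> and \<open>l\<close> these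
  colourings contribute \<open>3^n N0\<close>, so the claim reduces to two facts, where \<open>z i = l i / s\<close>.

  First, \<open>K(l) / multinom(l) \<le> C 3^(-m) exp (2 m (\<Sum>i. \<bar>z i - 1/3\<bar>)^k)\<close>. A filter by cube roots of unity
  shows that a column of independent letters with law \<open>z\<close> is admissible with probability \<open>q\<close> satisfying
  \<open>3 q \<le> 1 + 2 (\<Sum>i. \<bar>z i - 1/3\<bar>)^k\<close>. Given that all columns are admissible, the row sums form a walk on a
  two-dimensional lattice, which hits \<open>l\<close> with probability \<open>O(1/m)\<close>; by Stirling's formula,
  unconditioned letters have row sums \<open>l\<close> with probability at least a constant times \<open>1/m\<close>.

  Second, in a random colouring \<open>l i - s/3\<close> is sub-Gaussian at scale \<open>sqrt n\<close> for bounded tilts. The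
  weights \<open>j! [z^j]\<close> of the occupancy series \<open>e^z - 1 - z\<close> and of its tilted versions are increasing
  in \<open>j\<close>, which bounds ratios of consecutive coefficients of products of such series and allows one
  to replace the tilted factors one by one.

  As \<open>k \<ge> 3\<close>, near the centre the exponent in the first bound is at most a small multiple of
  \<open>\<Sum>i. (l i - s/3)^2 / n\<close>, whose exponential has bounded mean by the second.
\<close>

section \<open>Stirling bounds and binomial coefficients\<close>

lemma ln_one_plus_le_cubic:
  fixes x :: real
  assumes "0 \<le> x"
  shows "ln (1 + x) \<le> x - x\<^sup>2 / 2 + x ^ 3 / 3"
proof -
  have "(\<lambda>t. t - t\<^sup>2 / 2 + t ^ 3 / 3 - ln (1 + t)) 0 \<le> (\<lambda>t. t - t\<^sup>2 / 2 + t ^ 3 / 3 - ln (1 + t)) x"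
  proof (rule DERIV_nonneg_imp_nondecreasing[OF assms])
    fix t :: real assume t: "0 \<le> t" "t \<le> x"
    have "((\<lambda>t. t - t\<^sup>2 / 2 + t ^ 3 / 3 - ln (1 + t)) has_real_derivative (1 - t + t\<^sup>2 - 1 / (1 + t))) (at t)"
      using t by (auto intro!: derivative_eq_intros)
    moreover have "1 - t + t\<^sup>2 - 1 / (1 + t) = t ^ 3 / (1 + t)"
      using t by (simp add: field_simps power2_eq_square power3_eq_cube)
    ultimately show "\<exists>y. ((\<lambda>t. t - t\<^sup>2 / 2 + t ^ 3 / 3 - ln (1 + t)) has_real_derivative y) (at t) \<and> 0 \<le> y"
      using t by (intro exI[of _ "t ^ 3 / (1 + t)"]) auto
  qed
  then show ?thesis by simp
qed

text \<open>The bound is the [1/1] Pade approximant of the logarithm; multiplied by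
  \<open>1/x + 1/2\<close> it becomes exactly 1, which is what monotonicity of the Stirling defect
  requires.\<close>

lemma ln_one_plus_ge_pade:
  fixes x :: real
  assumes "0 \<le> x"
  shows "2 * x / (2 + x) \<le> ln (1 + x)"
proof -
  have "(\<lambda>t. ln (1 + t) - 2 * t / (2 + t)) 0 \<le> (\<lambda>t. ln (1 + t) - 2 * t / (2 + t)) x"
  proof (rule DERIV_nonneg_imp_nondecreasing[OF assms])
    fix t :: real assume t: "0 \<le> t" "t \<le> x"
    have "((\<lambda>t. ln (1 + t) - 2 * t / (2 + t)) has_real_derivative (1 / (1 + t) - 4 / (2 + t)\<^sup>2)) (at t)"
      using t by (auto intro!: derivative_eq_intros simp: power2_eq_square field_simps)
    moreover have "1 / (1 + t) - 4 / (2 + t)\<^sup>2 = t\<^sup>2 / ((1 + t) * (2 + t)\<^sup>2)"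
      using t by (simp add: divide_simps) (simp add: algebra_simps power2_eq_square)
    ultimately show "\<exists>y. ((\<lambda>t. ln (1 + t) - 2 * t / (2 + t)) has_real_derivative y) (at t) \<and> 0 \<le> y"
      using t by (intro exI[of _ "t\<^sup>2 / ((1 + t) * (2 + t)\<^sup>2)"]) auto
  qed
  then show ?thesis by simp
qed

text \<open>The logarithm of the ratio of \<open>n!\<close> to
  \<open>sqrt n * (n/e)^n\<close>.\<close>

definition stirling_defect :: "nat \<Rightarrow> real" where
  "stirling_defect n = ln (fact n) - (real n + 1 / 2) * ln (real n) + real n"

lemma stirling_defect_diff:
  assumes "n \<ge> 1"
  shows "stirling_defect n - stirling_defect (Suc n) = (real n + 1 / 2) * ln (1 + 1 / real n) - 1"
proof -
  have 1: "ln (1 + 1 / real n) = ln (real (Suc n)) - ln (real n)"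
  proof -
    have "1 + 1 / real n = real (Suc n) / real n" using assms by (simp add: field_simps)
    then show ?thesis using assms by (simp add: ln_div)
  qed
  have 2: "ln (fact (Suc n)) = ln (real (Suc n)) + ln (fact n :: real)"
    by (simp add: ln_mult)
  show ?thesis
    unfolding stirling_defect_def 1 2 by (simp add: algebra_simps)
qed

text \<open>The lower bound \<open>1/n\<close> rather than 0 makes the induction close: the defect
  is nonincreasing from its value 1 at \<open>n = 1\<close>, but each decrement is at most
  \<open>1/n - 1/(n+1)\<close>, so the defect minus \<open>1/n\<close> never falls below its initial
  value 0.\<close>

lemma stirling_defect_bounds:
  assumes "n \<ge> 1"
  shows "1 / real n \<le> stirling_defect n \<and> stirling_defect n \<le> 1"
  using assms
proof (induction n rule: nat_induct_at_least)
  case base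
  then show ?case by (simp add: stirling_defect_def)
next
  case (Suc n)
  define x where "x = 1 / real n"
  have x: "0 < x" "x \<le> 1" using Suc by (auto simp: x_def)
  have D: "stirling_defect n - stirling_defect (Suc n) = (1 / x + 1 / 2) * ln (1 + x) - 1"
    using stirling_defect_diff[of n] Suc(1) by (simp add: x_def)
  have "2 * x / (2 + x) \<le> ln (1 + x)" using x by (intro ln_one_plus_ge_pade) simp
  then have "(1 / x + 1 / 2) * (2 * x / (2 + x)) \<le> (1 / x + 1 / 2) * ln (1 + x)"
    using x by (intro mult_left_mono) auto
  moreover have "(1 / x + 1 / 2) * (2 * x / (2 + x)) = 1"
    using x by (simp add: divide_simps)
  ultimately have "stirling_defect (Suc n) \<le> stirling_defect n"
    using D by linarith
  moreover have "stirling_defect n - stirling_defect (Suc n) \<le> 1 / real n - 1 / real (Suc n)"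
  proof -
    have "(1 / x + 1 / 2) * ln (1 + x) \<le> (1 / x + 1 / 2) * (x - x\<^sup>2 / 2 + x ^ 3 / 3)"
      using x by (intro mult_left_mono ln_one_plus_le_cubic) auto
    also have "\<dots> = 1 + x\<^sup>2 / 12 + x ^ 3 / 6"
      using x by (simp add: field_simps power2_eq_square power3_eq_cube)
    also have "\<dots> \<le> 1 + x\<^sup>2 / 4"
      using x power_decreasing[of 2 3 x] by simp
    also have "\<dots> \<le> 1 + x\<^sup>2 / (1 + x)"
      using x by (intro add_left_mono divide_left_mono) auto
    also have "x\<^sup>2 / (1 + x) = 1 / real n - 1 / real (Suc n)"
      using x Suc(1) by (simp add: x_def field_simps power2_eq_square)
    finally show ?thesis
      using D by linarith
  qed
  ultimately show ?case using Suc by linarith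
qed

lemma fact_eq_stirling_defect:
  assumes "n \<ge> 1"
  shows "fact n = exp (stirling_defect n) * sqrt (real n) * (real n / exp 1) ^ n"
proof -
  have "fact n = exp (ln (fact n :: real))" by simp
  also have "ln (fact n) = stirling_defect n + ln (real n) / 2 + real n * (ln (real n) - 1)"
    by (simp add: stirling_defect_def algebra_simps)
  also have "exp \<dots> = exp (stirling_defect n) * exp (ln (real n) / 2) * exp (ln (real n) - 1) ^ n"
    by (simp add: exp_add exp_of_nat_mult)
  also have "exp (ln (real n) / 2) = sqrt (real n)"
    using assms by (simp add: ln_sqrt[symmetric])
  also have "exp (ln (real n) - 1) = real n / exp 1"
    using assms by (simp add: exp_diff)
  finally show ?thesis .
qed

lemma fact_ge_stirling:
  assumes "n \<ge> 1"
  shows "sqrt (real n) * (real n / exp 1) ^ n \<le> fact n"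
proof -
  have "0 \<le> stirling_defect n"
    using stirling_defect_bounds[OF assms] by (meson divide_nonneg_nonneg of_nat_0_le_iff order_trans zero_le_one)
  then have "1 * (sqrt (real n) * (real n / exp 1) ^ n) \<le> exp (stirling_defect n) * (sqrt (real n) * (real n / exp 1) ^ n)"
    by (intro mult_right_mono) auto
  then show ?thesis using fact_eq_stirling_defect[OF assms] by (simp add: mult.assoc)
qed

lemma fact_le_stirling:
  assumes "n \<ge> 1"
  shows "fact n \<le> exp 1 * sqrt (real n) * (real n / exp 1) ^ n"
proof -
  have "exp (stirling_defect n) * (sqrt (real n) * (real n / exp 1) ^ n) \<le> exp 1 * (sqrt (real n) * (real n / exp 1) ^ n)"
    using stirling_defect_bounds[OF assms] by (intro mult_right_mono) auto
  then show ?thesis using fact_eq_stirling_defect[OF assms] by (simp add: mult.assoc)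
qed

section \<open>Binomial coefficients are of order \<open>2^n / sqrt n\<close>\<close>

lemma central_binomial_Suc: "(2 * Suc n) choose (Suc n) = 2 * ((2 * n + 1) choose n)"
proof -
  have "(2 * n + 1) choose n = (2 * n + 1) choose (Suc n)"
    using binomial_symmetric[of n "2 * n + 1"] by simp
  moreover have "2 * Suc n = Suc (2 * n + 1)" by simp
  ultimately show ?thesis by (simp only: binomial_Suc_Suc)
qed

text \<open>The factor \<open>2n + 1\<close> is chosen so that the induction step reduces to
  \<open>(2n+1)(2n+3) \<le> (2n+2)^2\<close>.\<close>

lemma central_binomial_square_le: "((2 * n) choose n)\<^sup>2 * (2 * n + 1) \<le> 16 ^ n"
proof (induction n)
  case (Suc n)
  define B where "B = (2 * n) choose n"
  have 1: "(2 * Suc n) choose (Suc n) = 2 * ((2 * n + 1) choose n)"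
    by (rule central_binomial_Suc)
  have 2: "Suc n * ((2 * n + 1) choose n) = (2 * n + 1) * B"
    using binomial_absorb_comp[of "2 * n + 1" n] by (simp add: B_def)
  define X where "X = (2 * Suc n) choose (Suc n)"
  have "Suc n * X = 2 * (Suc n * ((2 * n + 1) choose n))"
    unfolding X_def 1 by (simp only: ac_simps)
  then have X: "Suc n * X = 2 * (2 * n + 1) * B" unfolding 2 by simp
  have "(Suc n)\<^sup>2 * (X\<^sup>2 * (2 * Suc n + 1)) = (Suc n * X)\<^sup>2 * (2 * n + 3)"
    by (simp add: power2_eq_square algebra_simps)
  also have "\<dots> = (4 * (2 * n + 1) * (2 * n + 3)) * (B\<^sup>2 * (2 * n + 1))"
    unfolding X by (simp add: power2_eq_square algebra_simps)
  also have "\<dots> \<le> (16 * (Suc n)\<^sup>2) * 16 ^ n"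
  proof (rule mult_mono)
    show "4 * (2 * n + 1) * (2 * n + 3) \<le> 16 * (Suc n)\<^sup>2"
      by (simp add: power2_eq_square algebra_simps)
  qed (use Suc in \<open>simp_all add: B_def\<close>)
  finally have "(Suc n)\<^sup>2 * (X\<^sup>2 * (2 * Suc n + 1)) \<le> (Suc n)\<^sup>2 * 16 ^ Suc n" by simp
  then show ?case unfolding X_def by (subst (asm) mult_le_cancel1) simp
qed simp

text \<open>The middle coefficient dominates its row; in an odd row it is half of the next central
  coefficient.\<close>

lemma binomial_square_le: "(n choose t)\<^sup>2 * (n + 1) \<le> 4 ^ n"
proof -
  have "(n choose t)\<^sup>2 * (n + 1) \<le> (n choose (n div 2))\<^sup>2 * (n + 1)"
    by (intro mult_right_mono power_mono binomial_maximum) auto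
  also have "\<dots> \<le> 4 ^ n"
  proof (cases "even n")
    case True
    then obtain k where n: "n = 2 * k" by (elim evenE)
    show ?thesis using central_binomial_square_le[of k] by (simp add: n power_mult)
  next
    case False
    then obtain k where n: "n = 2 * k + 1" by (elim oddE)
    define Y where "Y = (2 * k + 1) choose k"
    have "(2 * Suc k) choose Suc k = 2 * Y" unfolding Y_def by (rule central_binomial_Suc)
    from central_binomial_square_le[of "Suc k", unfolded this]
    have "(2 * Y)\<^sup>2 * (2 * k + 3) \<le> 16 * 16 ^ k" by (simp add: numeral_3_eq_3)
    then have "Y\<^sup>2 * (2 * k + 2) \<le> 4 * 16 ^ k"
      by (simp add: power2_eq_square algebra_simps)
    then show ?thesis by (simp add: n Y_def power_mult)
  qed
  finally show ?thesis .
qed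

text \<open>Each binomial is at most \<open>2^n / sqrt (n+1)\<close>. The inequality of arithmetic
  and geometric means turns the product of the two roots into a sum of reciprocals, whose summands
  can be treated separately in the induction over walks, of which this is the base case.\<close>

lemma binomial_mult_binomial_le:
  "real (i choose s) * real (j choose t) \<le> 2 ^ (i + j) * (1 / (real i + 1) + 1 / (real j + 1)) / 2"
proof -
  have *: "real (n choose s) \<le> 2 ^ n * sqrt (1 / (real n + 1))" for n s
  proof (rule power2_le_imp_le)
    have "real ((n choose s)\<^sup>2 * (n + 1)) \<le> real (4 ^ n)"
      using binomial_square_le of_nat_mono by blast
    then have "(real (n choose s))\<^sup>2 \<le> 4 ^ n / (real n + 1)"
      by (simp add: field_simps)
    also have "\<dots> = (2 ^ n * sqrt (1 / (real n + 1)))\<^sup>2"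
      by (simp add: power_mult_distrib power_mult[symmetric] mult.commute[of n 2] power_mult)
    finally show "(real (n choose s))\<^sup>2 \<le> (2 ^ n * sqrt (1 / (real n + 1)))\<^sup>2" .
  qed simp
  have "real (i choose s) * real (j choose t) \<le>
      (2 ^ i * sqrt (1 / (real i + 1))) * (2 ^ j * sqrt (1 / (real j + 1)))"
    by (intro mult_mono *) auto
  also have "\<dots> = 2 ^ (i + j) * sqrt ((1 / (real i + 1)) * (1 / (real j + 1)))"
    by (simp add: power_add real_sqrt_mult[symmetric])
  also have "\<dots> \<le> 2 ^ (i + j) * ((1 / (real i + 1) + 1 / (real j + 1)) / 2)"
    by (intro mult_left_mono arith_geo_mean_sqrt) auto
  finally show ?thesis by simp
qed

text \<open>The linear term is kept exactly, since it later cancels when the tilts of the three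
  colours are added.\<close>

lemma exp_le_quadratic: "exp x \<le> 1 + x + x\<^sup>2 * exp \<bar>x\<bar>" for x :: real
proof -
  have "(1 - x) * exp x \<le> exp (- x) * exp x"
    using exp_ge_add_one_self[of "-x"] by (intro mult_right_mono) auto
  then have *: "exp x - 1 \<le> x * exp x" by (simp add: algebra_simps exp_minus)
  show ?thesis
  proof (cases "x \<ge> 0")
    case True
    then have "x * (exp x - 1) \<le> x * (x * exp x)" using * by (intro mult_left_mono)
    then show ?thesis using * True by (simp add: power2_eq_square algebra_simps)
  next
    case False
    have "1 - exp x \<le> -x" using exp_ge_add_one_self[of x] by linarith
    then have "(-x) * (1 - exp x) \<le> (-x) * (-x)"
      using False by (intro mult_left_mono) auto
    then have "exp x \<le> 1 + x + x\<^sup>2 * 1" using * by (simp add: power2_eq_square algebra_simps)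
    also have "x\<^sup>2 * 1 \<le> x\<^sup>2 * exp \<bar>x\<bar>" by (intro mult_left_mono) auto
    finally show ?thesis by simp
  qed
qed

section \<open>A local bound for lattice walks\<close>

lemma sum_PiE_lessThan_Suc:
  assumes "finite S"
  shows "(\<Sum>f\<in>{..<Suc n} \<rightarrow>\<^sub>E S. G f) = (\<Sum>s\<in>S. \<Sum>f\<in>{..<n} \<rightarrow>\<^sub>E S. G (f(n := s)))"
proof -
  have "(\<Sum>f\<in>{..<Suc n} \<rightarrow>\<^sub>E S. G f) = (\<Sum>(s, f)\<in>S \<times> ({..<n} \<rightarrow>\<^sub>E S). G (f(n := s)))"
    unfolding lessThan_Suc PiE_insert_eq
    by (subst sum.reindex[OF inj_combinator]) (auto simp: o_def case_prod_unfold)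
  then show ?thesis by (simp add: sum.cartesian_product)
qed

text \<open>The lower index is an integer, with value 0 when negative, so that Pascal's rule holds
  everywhere and reads as a translation identity.\<close>

definition int_choose :: "nat \<Rightarrow> int \<Rightarrow> real" where
  "int_choose n t = (if t < 0 then 0 else real (n choose nat t))"

lemma int_choose_Suc: "int_choose (Suc n) t = int_choose n t + int_choose n (t - 1)"
proof (cases "t \<le> 0")
  case True
  then show ?thesis by (cases "t = 0") (auto simp: int_choose_def)
next
  case False
  then have "nat t = Suc (nat (t - 1))" by simp
  then show ?thesis using False by (simp add: int_choose_def)
qed

text \<open>Up to the factor \<open>2^(i+j)\<close>, the law of \<open>i\<close> fair coin flips in
  the first direction and \<open>j\<close> in the second.\<close>

definition two_choose :: "nat \<Rightarrow> nat \<Rightarrow> int \<times> int \<Rightarrow> real" where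
  "two_choose i j x = int_choose i (fst x) * int_choose j (snd x)"

text \<open>One step of the walk acting on functions: convolution with the law of an increment
  \<open>v s\<close>, where \<open>s\<close> has weight \<open>p s\<close>.\<close>

definition conv_step :: "'c set \<Rightarrow> ('c \<Rightarrow> real) \<Rightarrow> ('c \<Rightarrow> int \<times> int) \<Rightarrow> (int \<times> int \<Rightarrow> real) \<Rightarrow> int \<times> int \<Rightarrow> real" where
  "conv_step S p v h x = (\<Sum>s\<in>S. p s * h (x - v s))"

lemma conv_step_pow_Suc:
  "(conv_step S p v ^^ Suc m) h x = (\<Sum>s\<in>S. p s * (conv_step S p v ^^ m) h (x - v s))"
  by (simp, subst conv_step_def, rule refl)

text \<open>Convolution is linear and commutes with translation. By Pascal's rule,
  \<open>h x + h (x - a)\<close> amounts to adding a coin flip in direction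
  \<open>a\<close>.\<close>

lemma conv_step_pow_shift:
  "(conv_step S p v ^^ m) (\<lambda>x. h x + h (x - a)) x =
   (conv_step S p v ^^ m) h x + (conv_step S p v ^^ m) h (x - a)"
proof (induction m arbitrary: x)
  case (Suc m)
  have "x - v s - a = x - a - v s" for s by (simp add: algebra_simps)
  then show ?case
    by (simp only: conv_step_pow_Suc Suc sum.distrib distrib_left)
qed simp

lemma two_choose_Suc_left: "two_choose (Suc i) j = (\<lambda>x. two_choose i j x + two_choose i j (x - (1, 0)))"
  by (rule ext) (simp add: two_choose_def int_choose_Suc algebra_simps)

lemma two_choose_Suc_right: "two_choose i (Suc j) = (\<lambda>x. two_choose i j x + two_choose i j (x - (0, 1)))"
  by (rule ext) (simp add: two_choose_def int_choose_Suc algebra_simps)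

text \<open>Moving mass \<open>2\<mu>\<close> from \<open>x\<close> to \<open>x + 1\<close> lowers
  the average of the reciprocal by \<open>2\<mu> / (x(x+1))\<close>, while only
  \<open>\<mu> / (x(x+\<mu>))\<close> is required; \<open>x + 1 \<le> 2x\<close> suffices.\<close>

lemma reciprocal_superharmonic:
  fixes x \<mu> :: real
  assumes "1 \<le> x" "0 \<le> \<mu>"
  shows "(1 - 2 * \<mu>) * (1 / x) + 2 * \<mu> * (1 / (x + 1)) \<le> 1 / (x + \<mu>)"
proof -
  have "(1 - 2 * \<mu>) * (1 / x) + 2 * \<mu> * (1 / (x + 1)) = 1 / x - 2 * \<mu> / (x * (x + 1))"
    using assms by (simp add: divide_simps) (simp add: algebra_simps)
  also have "\<dots> \<le> 1 / x - \<mu> / (x * (x + \<mu>))"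
  proof -
    have "\<mu> * (x + 1) \<le> 2 * \<mu> * (x + \<mu>)"
    proof -
      have "\<mu> * 1 \<le> \<mu> * x" using assms by (intro mult_left_mono) auto
      moreover have "0 \<le> \<mu> * \<mu>" by simp
      ultimately show ?thesis unfolding distrib_left by linarith
    qed
    then have "\<mu> / (x + \<mu>) \<le> 2 * \<mu> / (x + 1)"
      using assms by (simp add: divide_simps)
    then have "\<mu> / (x + \<mu>) / x \<le> 2 * \<mu> / (x + 1) / x"
      using assms by (intro divide_right_mono) auto
    then show ?thesis by (simp add: mult.commute)
  qed
  also have "\<dots> = 1 / (x + \<mu>)"
    using assms by (simp add: divide_simps)
  finally show ?thesis .
qed

text \<open>Splitting off a mass \<open>\<mu>\<close> of coin flips in each of the two coordinate directions turns a
  step of the walk into a mixture that either moves freely or increases the number \<open>i\<close> or \<open>j\<close>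
  of coin flips already made.\<close>

lemma conv_step_pow_two_choose_le:
  assumes "finite S" and p: "\<And>s. s \<in> S \<Longrightarrow> 0 \<le> p s" and "sum p S = 1"
    and S: "c \<in> S" "a \<in> S" "b \<in> S" and distinct: "c \<noteq> a" "c \<noteq> b" "a \<noteq> b"
    and v: "v c = 0" "v a = (1, 0)" "v b = (0, 1)"
    and \<mu>: "0 \<le> \<mu>" "2 * \<mu> \<le> p c" "\<mu> \<le> p a" "\<mu> \<le> p b"
  shows "(conv_step S p v ^^ m) (two_choose i j) x
    \<le> 2 ^ (i + j) * (1 / (real i + 1 + \<mu> * real m) + 1 / (real j + 1 + \<mu> * real m)) / 2"
proof (induction m arbitrary: i j x)
  case 0
  show ?case
  proof (cases "fst x < 0 \<or> snd x < 0")
    case True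
    then show ?thesis by (auto simp: two_choose_def int_choose_def intro!: divide_nonneg_nonneg add_nonneg_nonneg)
  next
    case False
    then show ?thesis
      using binomial_mult_binomial_le[of i "nat (fst x)" j "nat (snd x)"]
      by (simp add: two_choose_def int_choose_def)
  qed
next
  case (Suc m)
  define F where "F = (conv_step S p v ^^ m) (two_choose i j)"
  \<comment> \<open>One flip takes mass \<open>\<mu>\<close> from \<open>c\<close> and
    \<open>\<mu>\<close> from \<open>a\<close>, the other \<open>\<mu>\<close> from \<open>c\<close>
    and \<open>\<mu>\<close> from \<open>b\<close>; hence the demand
    \<open>2\<mu> \<le> p c\<close>. The rest \<open>r\<close> has total mass
    \<open>1 - 4\<mu>\<close>.\<close>
  define r where "r s = p s - (if s = c then 2 * \<mu> else 0) - (if s = a then \<mu> else 0) - (if s = b then \<mu> else 0)" for s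
  define \<Phi> where "\<Phi> i j = 2 ^ (i + j) * (1 / (real i + 1 + \<mu> * real m) + 1 / (real j + 1 + \<mu> * real m)) / 2" for i j :: nat
  have \<Phi>: "(conv_step S p v ^^ m) (two_choose i j) x \<le> \<Phi> i j" for i j x
    using Suc by (simp only: \<Phi>_def)
  have r: "0 \<le> r s" if "s \<in> S" for s
    using p[OF that] \<mu> distinct by (auto simp: r_def)
  have sum_r: "sum r S = 1 - 4 * \<mu>"
    using assms by (simp add: r_def sum_subtractf sum.delta')
  have "(\<Sum>s\<in>S. p s * F (x - v s)) = (\<Sum>s\<in>S. r s * F (x - v s) + (if s = c then 2 * \<mu> * F (x - v s) else 0)
      + (if s = a then \<mu> * F (x - v s) else 0) + (if s = b then \<mu> * F (x - v s) else 0))"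
    by (rule sum.cong) (auto simp: r_def algebra_simps)
  also have "\<dots> = (\<Sum>s\<in>S. r s * F (x - v s)) + \<mu> * (F x + F (x - (1, 0))) + \<mu> * (F x + F (x - (0, 1)))"
    using assms(1) S v by (simp add: sum.distrib sum.delta' algebra_simps)
  also have "F x + F (x - (1, 0)) = (conv_step S p v ^^ m) (two_choose (Suc i) j) x"
    unfolding F_def two_choose_Suc_left conv_step_pow_shift ..
  also have "F x + F (x - (0, 1)) = (conv_step S p v ^^ m) (two_choose i (Suc j)) x"
    unfolding F_def two_choose_Suc_right conv_step_pow_shift ..
  also have "(\<Sum>s\<in>S. r s * F (x - v s)) + \<mu> * (conv_step S p v ^^ m) (two_choose (Suc i) j) x
      + \<mu> * (conv_step S p v ^^ m) (two_choose i (Suc j)) x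
      \<le> (\<Sum>s\<in>S. r s * \<Phi> i j) + \<mu> * \<Phi> (Suc i) j + \<mu> * \<Phi> i (Suc j)"
    unfolding F_def by (intro add_mono sum_mono mult_left_mono \<Phi> r \<mu>(1))
  \<comment> \<open>An extra flip doubles the prefactor, so each direction carries mass
    \<open>2\<mu>\<close>. The reciprocal in \<open>i\<close> is unaffected by a flip in the other
    direction, which raises its unmoved weight from \<open>1 - 4\<mu>\<close> to
    \<open>1 - 2\<mu>\<close>; likewise for \<open>j\<close>.\<close>
  also have "\<dots> = 2 ^ (i + j) / 2 *
      (((1 - 2 * \<mu>) * (1 / (real i + 1 + \<mu> * real m)) + 2 * \<mu> * (1 / (real i + 1 + \<mu> * real m + 1)))
     + ((1 - 2 * \<mu>) * (1 / (real j + 1 + \<mu> * real m)) + 2 * \<mu> * (1 / (real j + 1 + \<mu> * real m + 1))))"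
  proof -
    have [simp]: "real (Suc i') + 1 + \<mu> * real m = real i' + 1 + \<mu> * real m + 1" for i' by simp
    define A where "A i = 1 / (real i + 1 + \<mu> * real m)" for i :: nat
    define B where "B i = 1 / (real i + 1 + \<mu> * real m + 1)" for i :: nat
    show ?thesis
      unfolding sum_distrib_right[symmetric] sum_r
      by (simp add: \<Phi>_def A_def[symmetric] B_def[symmetric] del: of_nat_Suc) (simp add: algebra_simps)
  qed
  also have "\<dots> \<le> 2 ^ (i + j) / 2 *
      (1 / (real i + 1 + \<mu> * real m + \<mu>) + 1 / (real j + 1 + \<mu> * real m + \<mu>))"
    using \<mu>(1) by (intro mult_left_mono add_mono reciprocal_superharmonic) auto
  also have "\<dots> = 2 ^ (i + j) * (1 / (real i + 1 + \<mu> * real (Suc m)) + 1 / (real j + 1 + \<mu> * real (Suc m))) / 2"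
  proof -
    have "real i + 1 + \<mu> * real m + \<mu> = real i + 1 + \<mu> * real (Suc m)" for i
      by (simp add: algebra_simps)
    then show ?thesis by (simp only: times_divide_eq_left)
  qed
  finally show ?case by (simp only: conv_step_pow_Suc F_def)
qed

text \<open>\<open>two_choose 0 0\<close> is the indicator of the origin, so the iterates are the
  law of the walk itself.\<close>

lemma conv_step_pow_eq_sum_PiE:
  assumes "finite S"
  shows "(conv_step S p v ^^ m) (two_choose 0 0) x =
    (\<Sum>\<kappa>\<in>{..<m} \<rightarrow>\<^sub>E S. if (\<Sum>j<m. v (\<kappa> j)) = x then \<Prod>j<m. p (\<kappa> j) else 0)"
proof (induction m arbitrary: x)
  case 0
  have "int_choose 0 t = (if t = 0 then 1 else 0)" for t
    by (auto simp: int_choose_def)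
  then show ?case by (auto simp: two_choose_def zero_prod_def prod_eq_iff)
next
  case (Suc m)
  have eq: "(\<Sum>j<m. v ((f(m := s)) j)) = (\<Sum>j<m. v (f j))" "(\<Prod>j<m. p ((f(m := s)) j)) = (\<Prod>j<m. p (f j))" for f s
    by (auto intro!: sum.cong prod.cong)
  have "p s * (if (\<Sum>j<m. v (f j)) = x - v s then \<Prod>j<m. p (f j) else 0) =
      (if (\<Sum>j<Suc m. v ((f(m := s)) j)) = x then \<Prod>j<Suc m. p ((f(m := s)) j) else 0)" for f s
    unfolding sum.lessThan_Suc prod.lessThan_Suc eq fun_upd_same eq_diff_eq by simp
  then show ?case
    unfolding sum_PiE_lessThan_Suc[OF assms] conv_step_pow_Suc Suc sum_distrib_left
    by (intro sum.cong refl)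
qed

section \<open>The number of admissible matrices\<close>

definition admissible :: "nat \<Rightarrow> (nat \<Rightarrow> nat) set" where
  "admissible k = {\<kappa> \<in> compositions3 k. [\<kappa> 1 = \<kappa> 2] (mod 3)}"

text \<open>For a probability vector \<open>z\<close>, the probability that independent letters with
  law \<open>z\<close>, as many as the column sum, have the letter counts
  \<open>\<kappa>\<close>.\<close>

definition column_weight :: "(nat \<Rightarrow> real) \<Rightarrow> (nat \<Rightarrow> nat) \<Rightarrow> real" where
  "column_weight z \<kappa> = multinom {..<3} \<kappa> * (\<Prod>i<3. z i ^ \<kappa> i)"

text \<open>Coordinates of the lattice spanned by the admissible columns.\<close>

definition column_coords :: "(nat \<Rightarrow> nat) \<Rightarrow> int \<times> int" where
  "column_coords \<kappa> = (int (\<kappa> 2), (int (\<kappa> 1) - int (\<kappa> 2)) div 3)"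

lemma finite_admissible: "finite (admissible k)"
  unfolding admissible_def using finite_compositions3 by simp

lemma sum_lessThan_3: "(\<Sum>i<3. f i) = f 0 + f 1 + f (2::nat)" for f :: "nat \<Rightarrow> 'a::comm_monoid_add"
  by (simp add: eval_nat_numeral)

lemma prod_lessThan_3: "(\<Prod>i<3. f i) = f 0 * f 1 * f (2::nat)" for f :: "nat \<Rightarrow> 'a::comm_monoid_mult"
  by (simp add: eval_nat_numeral)

lemma compositions3_sum: "v \<in> compositions3 s \<Longrightarrow> v 0 + v 1 + v 2 = s"
  by (simp add: compositions3_def sum_lessThan_3)

lemma multinom_eq_choose:
  fixes v :: "nat \<Rightarrow> nat"
  shows "multinom {..<3} v = real ((v 0 + v 1 + v 2) choose v 0) * real ((v 1 + v 2) choose v 1)"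
  by (simp add: multinom_def sum_lessThan_3 prod_lessThan_3 binomial_fact add.assoc)

lemma multinom_ge_1: "1 \<le> multinom {..<3} \<kappa>" for \<kappa> :: "nat \<Rightarrow> nat"
proof -
  have "1 \<le> ((\<kappa> 0 + \<kappa> 1 + \<kappa> 2) choose \<kappa> 0) * ((\<kappa> 1 + \<kappa> 2) choose \<kappa> 1)"
    by (simp add: Suc_le_eq)
  then show ?thesis
    unfolding multinom_eq_choose by (metis of_nat_1 of_nat_le_iff of_nat_mult)
qed

lemma multinom_pos: "0 < multinom {..<3} \<kappa>" for \<kappa> :: "nat \<Rightarrow> nat"
  using multinom_ge_1[of \<kappa>] by simp

lemma column_weight_nonneg: "(\<And>i. 0 \<le> z i) \<Longrightarrow> 0 \<le> column_weight z \<kappa>"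
  unfolding column_weight_def by (intro mult_nonneg_nonneg prod_nonneg less_imp_le[OF multinom_pos]) auto

text \<open>The congruence makes every division by 3 exact, hence additive over columns.\<close>

lemma sum_column_coords:
  assumes "\<And>j. j < m \<Longrightarrow> [\<kappa> j 1 = \<kappa> j 2] (mod 3)"
    and "\<And>i. i < 3 \<Longrightarrow> (\<Sum>j<m. \<kappa> j i) = l i"
  shows "(\<Sum>j<m. column_coords (\<kappa> j)) = column_coords l"
proof -
  define d where "d j = (int (\<kappa> j 1) - int (\<kappa> j 2)) div 3" for j
  have d: "int (\<kappa> j 1) - int (\<kappa> j 2) = 3 * d j" if "j < m" for j
    using assms(1)[OF that] unfolding d_def
    by (metis cong_iff_dvd_diff cong_int_iff dvd_mult_div_cancel of_nat_numeral)
  have l: "int (l i) = (\<Sum>j<m. int (\<kappa> j i))" if "i < 3" for i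
    using assms(2)[OF that] by (metis of_nat_sum)
  have "int (l 1) - int (l 2) = (\<Sum>j<m. 3 * d j)"
    using d by (simp add: l sum_subtractf[symmetric])
  then have "(int (l 1) - int (l 2)) div 3 = (\<Sum>j<m. d j)"
    by (simp add: sum_distrib_left[symmetric])
  then show ?thesis
    by (simp add: prod_eq_iff column_coords_def fst_sum snd_sum l d_def)
qed

text \<open>All matrices counted by \<open>K\<close> have row sums \<open>l\<close>, so a tilt by
  \<open>z\<close> multiplies each of them by the same factor.\<close>

lemma K_mult_powers:
  "K k m l * (\<Prod>i<3. z i ^ l i) = (\<Sum>\<kappa>\<in>matrices k m l. \<Prod>j<m. column_weight z (\<kappa> j))"
proof -
  have "(\<Prod>i<3. z i ^ l i) = (\<Prod>j<m. \<Prod>i<3. z i ^ \<kappa> j i)" if "\<kappa> \<in> matrices k m l" for \<kappa>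
  proof -
    have "(\<Prod>i<3. z i ^ l i) = (\<Prod>i<3. \<Prod>j<m. z i ^ \<kappa> j i)"
      using that by (intro prod.cong refl) (simp add: matrices_def power_sum[symmetric])
    then show ?thesis by (subst prod.swap) simp
  qed
  then show ?thesis
    by (simp add: K_def column_weight_def prod.distrib sum_distrib_right)
qed

text \<open>Normalised by \<open>q\<close>, the column weights are a step law on admissible columns.
  The left side is then at most \<open>q^m\<close> times the probability that the walk of column
  coordinates is at \<open>column_coords l\<close> after \<open>m\<close> steps.\<close>

lemma K_local_bound:
  assumes k: "k \<ge> 3" and m: "m > 0"
    and z: "\<And>i. 0 \<le> z i" "\<And>i. i < 3 \<Longrightarrow> \<beta> \<le> z i" and "0 < \<beta>"
    and q: "q = sum (column_weight z) (admissible k)" "q \<le> 1"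
  shows "K k m l * (\<Prod>i<3. z i ^ l i) \<le> 2 * q ^ m / (\<beta> ^ k * real m)"
proof -
  \<comment> \<open>Half of the least weight \<open>\<beta>^k\<close> of a column, because the
    column \<open>c\<close> has to provide mass \<open>2\<mu>\<close>.\<close>
  define \<mu> where "\<mu> = \<beta> ^ k / 2"
  define vec where "vec a b c = (\<lambda>i\<in>{..<3::nat}. if i = 0 then a else if i = 1 then b else c)" for a b c :: nat
  have vec: "vec a b c \<in> admissible k" if "a + b + c = k" "[b = c] (mod 3)" for a b c
    using that by (auto simp: admissible_def compositions3_def vec_def sum_lessThan_3)
  have coords: "column_coords (vec a b c) = (int c, (int b - int c) div 3)" for a b c
    by (simp add: column_coords_def vec_def)
  have weight: "\<beta> ^ k \<le> column_weight z (vec a b c)" if "a + b + c = k" for a b c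
  proof -
    have "\<beta> ^ k = \<beta> ^ a * \<beta> ^ b * \<beta> ^ c" using that by (simp add: power_add[symmetric])
    also have "\<dots> \<le> z 0 ^ a * z 1 ^ b * z 2 ^ c"
      using z \<open>0 < \<beta>\<close> by (intro mult_mono power_mono) auto
    also have "\<dots> = 1 * (\<Prod>i<3. z i ^ vec a b c i)" by (simp add: prod_lessThan_3 vec_def)
    also have "\<dots> \<le> column_weight z (vec a b c)"
      unfolding column_weight_def using z by (intro mult_right_mono multinom_ge_1 prod_nonneg) auto
    finally show ?thesis .
  qed
  \<comment> \<open>Three columns whose coordinates are the origin and the two unit vectors; the
    last one exists because \<open>k \<ge> 3\<close>.\<close>
  define c where "c = vec k 0 0"
  define a where "a = vec (k - 2) 1 1"
  define b where "b = vec (k - 3) 3 0"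
  have S: "c \<in> admissible k" "a \<in> admissible k" "b \<in> admissible k"
    using k by (auto simp: a_def b_def c_def cong_def intro!: vec)
  have v: "column_coords c = 0" "column_coords a = (1, 0)" "column_coords b = (0, 1)"
    by (simp_all add: a_def b_def c_def coords zero_prod_def)
  have w: "\<beta> ^ k \<le> column_weight z c" "\<beta> ^ k \<le> column_weight z a" "\<beta> ^ k \<le> column_weight z b"
    using k by (auto simp: a_def b_def c_def intro!: weight)
  have nn: "0 \<le> column_weight z s" for s using z by (intro column_weight_nonneg)
  have "column_weight z c \<le> q"
    unfolding q by (intro member_le_sum S nn finite_admissible)
  with w have q0: "q > 0" using \<open>0 < \<beta>\<close> zero_less_power[of \<beta> k] by linarith
  define p where "p s = column_weight z s / q" for s
  have p_ge: "column_weight z s \<le> p s" for s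
    using nn[of s] q0 \<open>q \<le> 1\<close> by (simp add: p_def pos_le_divide_eq mult_left_le)
  have eq: "K k m l * (\<Prod>i<3. z i ^ l i) = q ^ m * (\<Sum>\<kappa>\<in>matrices k m l. \<Prod>j<m. p (\<kappa> j))"
    using q0 by (simp add: K_mult_powers p_def prod_dividef sum_divide_distrib[symmetric])
  have "(\<Sum>\<kappa>\<in>matrices k m l. \<Prod>j<m. p (\<kappa> j)) \<le>
      (\<Sum>\<kappa>\<in>{..<m} \<rightarrow>\<^sub>E admissible k. if (\<Sum>j<m. column_coords (\<kappa> j)) = column_coords l then \<Prod>j<m. p (\<kappa> j) else 0)"
    (is "_ \<le> ?R")
  proof -
    have sub: "\<kappa> \<in> {..<m} \<rightarrow>\<^sub>E admissible k \<and> (\<Sum>j<m. column_coords (\<kappa> j)) = column_coords l"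
      if "\<kappa> \<in> matrices k m l" for \<kappa>
      using that by (auto simp: matrices_def admissible_def intro!: sum_column_coords)
    have fin: "finite ({..<m} \<rightarrow>\<^sub>E admissible k)" by (intro finite_PiE finite_admissible) simp
    have "(\<Sum>\<kappa>\<in>matrices k m l. \<Prod>j<m. p (\<kappa> j)) =
      (\<Sum>\<kappa>\<in>matrices k m l. if (\<Sum>j<m. column_coords (\<kappa> j)) = column_coords l then \<Prod>j<m. p (\<kappa> j) else 0)"
      using sub by (intro sum.cong) auto
    also have "\<dots> \<le> ?R"
      using sub nn q0 by (intro sum_mono2 fin) (auto simp: p_def intro!: prod_nonneg)
    finally show ?thesis .
  qed
  also have "?R = (conv_step (admissible k) p column_coords ^^ m) (two_choose 0 0) (column_coords l)"
    by (rule conv_step_pow_eq_sum_PiE[OF finite_admissible, symmetric])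
  also have "\<dots> \<le> 2 ^ (0 + 0) * (1 / (real 0 + 1 + \<mu> * real m) + 1 / (real 0 + 1 + \<mu> * real m)) / 2"
  proof (rule conv_step_pow_two_choose_le[where c = c and a = a and b = b])
    show "sum p (admissible k) = 1"
      using q0 by (simp add: p_def sum_divide_distrib[symmetric] q(1))
    show "c \<noteq> a" "c \<noteq> b" "a \<noteq> b" using v by (auto simp: zero_prod_def)
    show "0 \<le> \<mu>" using \<open>0 < \<beta>\<close> by (simp add: \<mu>_def)
    show "2 * \<mu> \<le> p c" using w(1) p_ge[of c] by (simp add: \<mu>_def)
    have "\<mu> \<le> \<beta> ^ k" using \<open>0 < \<beta>\<close> by (simp add: \<mu>_def)
    then show "\<mu> \<le> p a" "\<mu> \<le> p b" using w p_ge[of a] p_ge[of b] by linarith+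
    show "0 \<le> p s" for s using nn q0 by (simp add: p_def)
  qed (use finite_admissible S v in auto)
  also have "\<dots> = 1 / (1 + \<mu> * real m)" unfolding of_nat_0 add_0_left field_sum_of_halves
    by (simp only: power_0 mult_1 add_divide_distrib field_sum_of_halves)
  also have "\<dots> \<le> 1 / (\<mu> * real m)"
    using m \<open>0 < \<beta>\<close> by (intro divide_left_mono mult_pos_pos add_pos_pos) (auto simp: \<mu>_def)
  finally have "q ^ m * (\<Sum>\<kappa>\<in>matrices k m l. \<Prod>j<m. p (\<kappa> j)) \<le> q ^ m * (1 / (\<mu> * real m))"
    using q0 by (intro mult_left_mono) auto
  moreover have "q ^ m * (1 / (\<mu> * real m)) = 2 * q ^ m / (\<beta> ^ k * real m)"
    by (simp add: \<mu>_def)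
  ultimately show ?thesis unfolding eq by (rule ord_le_eq_trans)
qed

section \<open>Trinomial expansion and the filter by cube roots of unity\<close>

lemma sum_compositions3:
  fixes G :: "nat \<Rightarrow> nat \<Rightarrow> nat \<Rightarrow> 'a::comm_monoid_add"
  shows "(\<Sum>v\<in>compositions3 n. G (v 0) (v 1) (v 2)) = (\<Sum>i\<le>n. \<Sum>j\<le>n - i. G i j (n - i - j))"
proof -
  define \<phi> where "\<phi> = (\<lambda>(a, b). \<lambda>i\<in>{..<3::nat}. if i = 0 then a else if i = 1 then b else n - a - b)"
  have \<phi>: "\<phi> p 0 = fst p" "\<phi> p 1 = snd p" "\<phi> p 2 = n - fst p - snd p"
    and ext_\<phi>: "\<phi> p \<in> extensional {..<3}" for p
    by (simp_all add: \<phi>_def case_prod_unfold)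
  have "(\<Sum>i\<le>n. \<Sum>j\<le>n - i. G i j (n - i - j)) = (\<Sum>(i, j)\<in>(SIGMA i:{..n}. {..n - i}). G i j (n - i - j))"
    by (subst sum.Sigma) auto
  also have "\<dots> = (\<Sum>v\<in>compositions3 n. G (v 0) (v 1) (v 2))"
  proof (rule sum.reindex_bij_witness[where i = "\<lambda>v. (v 0, v 1)" and j = \<phi>])
    fix v assume v: "v \<in> compositions3 n"
    then have sum: "v 0 + v 1 + v 2 = n" by (rule compositions3_sum)
    from v have ext: "v \<in> extensional {..<3}" by (simp add: compositions3_def PiE_def)
    show "\<phi> (v 0, v 1) = v"
    proof (rule extensionalityI[OF ext_\<phi> ext])
      fix x :: nat assume "x \<in> {..<3}"
      then have "x = 0 \<or> x = 1 \<or> x = 2" by auto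
      then show "\<phi> (v 0, v 1) x = v x" using sum \<phi>[of "(v 0, v 1)"] by auto
    qed
    show "(v 0, v 1) \<in> (SIGMA i:{..n}. {..n - i})" using sum by auto
  next
    fix p assume p: "p \<in> (SIGMA i:{..n}. {..n - i})"
    show "\<phi> p \<in> compositions3 n"
      unfolding compositions3_def mem_Collect_eq sum_lessThan_3 \<phi> using p ext_\<phi>[of p]
      by (auto simp: PiE_def)
    show "(\<phi> p 0, \<phi> p 1) = p" unfolding \<phi> by simp
    show "G (\<phi> p 0) (\<phi> p 1) (\<phi> p 2) = (case p of (i, j) \<Rightarrow> G i j (n - i - j))"
      unfolding \<phi> by (simp add: case_prod_unfold)
  qed
  finally show ?thesis by simp
qed

text \<open>Stated over commutative rings, with integral coefficients in place of
  \<open>multinom\<close>, to serve for real and complex numbers and for formal power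
  series.\<close>

lemma trinomial:
  fixes a b c :: "'a::comm_ring_1"
  shows "(\<Sum>v\<in>compositions3 n. of_nat ((n choose v 0) * ((n - v 0) choose v 1)) * a ^ v 0 * b ^ v 1 * c ^ v 2) = (a + b + c) ^ n"
proof -
  have "(\<Sum>v\<in>compositions3 n. of_nat ((n choose v 0) * ((n - v 0) choose v 1)) * a ^ v 0 * b ^ v 1 * c ^ v 2)
      = (\<Sum>i\<le>n. \<Sum>j\<le>n - i. of_nat ((n choose i) * ((n - i) choose j)) * a ^ i * b ^ j * c ^ (n - i - j))"
    by (rule sum_compositions3)
  also have "\<dots> = (\<Sum>i\<le>n. of_nat (n choose i) * a ^ i * (b + c) ^ (n - i))"
    by (rule sum.cong) (auto simp: binomial_ring[of b c] sum_distrib_left algebra_simps)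
  also have "\<dots> = (a + b + c) ^ n"
    by (simp add: binomial_ring[of a "b + c"] add.assoc)
  finally show ?thesis .
qed

lemma multinom_compositions3:
  "v \<in> compositions3 n \<Longrightarrow> multinom {..<3} v = real ((n choose v 0) * ((n - v 0) choose v 1))"
  using compositions3_sum[of v n] by (auto simp: multinom_eq_choose)

text \<open>The exponent \<open>a + 2b\<close> is congruent to \<open>a - b\<close> modulo 3 and
  stays a natural number.\<close>

lemma root_of_unity_filter:
  fixes \<omega> :: complex
  assumes "\<omega> ^ 3 = 1" "1 + \<omega> + \<omega>\<^sup>2 = 0"
  shows "(\<Sum>r<3. (\<omega> ^ r) ^ (a + 2 * b)) = (if [a = b] (mod 3) then 3 else 0)"
proof -
  define e where "e = a + 2 * b"
  have red: "\<omega> ^ n = \<omega> ^ (n mod 3)" for n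
  proof -
    have "\<omega> ^ n = \<omega> ^ (3 * (n div 3) + n mod 3)" by simp
    also have "\<dots> = \<omega> ^ (n mod 3)" unfolding power_add power_mult assms(1) by simp
    finally show ?thesis .
  qed
  have cong: "[a = b] (mod 3) \<longleftrightarrow> e mod 3 = 0"
    unfolding cong_def e_def by presburger
  have "(\<Sum>r<3. (\<omega> ^ r) ^ e) = 1 + \<omega> ^ e + (\<omega> ^ e)\<^sup>2"
    by (simp add: sum_lessThan_3 power_mult[symmetric] mult.commute)
  then have "(\<Sum>r<3. (\<omega> ^ r) ^ e) = 1 + \<omega> ^ (e mod 3) + (\<omega> ^ (e mod 3))\<^sup>2"
    by (simp only: red[of e])
  moreover have "e mod 3 = 0 \<or> e mod 3 = 1 \<or> e mod 3 = 2" by auto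
  moreover have "(\<omega>\<^sup>2)\<^sup>2 = \<omega>"
    using red[of 4] by (simp add: power_mult[symmetric])
  ultimately show ?thesis
    using assms(2) unfolding cong e_def by (auto simp: algebra_simps)
qed

text \<open>By the filter and the trinomial expansion, three times the sum equals
  \<open>1 + Z 1^k + Z 2^k\<close> for the character sums \<open>Z r\<close> of \<open>z\<close>. A
  nontrivial character has mean zero, so \<open>z i\<close> may be replaced by
  \<open>z i - 1/3\<close> in \<open>Z r\<close>, and the triangle inequality applies.\<close>

lemma sum_column_weight_le:
  fixes z :: "nat \<Rightarrow> real"
  assumes z: "z 0 + z 1 + z 2 = 1"
  shows "sum (column_weight z) (admissible k) \<le> (1 + 2 * (\<Sum>i<3. \<bar>z i - 1 / 3\<bar>) ^ k) / 3"
proof -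
  define \<omega> where "\<omega> = cis (2 * pi / 3)"
  have \<omega>3: "\<omega> ^ 3 = 1" unfolding \<omega>_def Complex.DeMoivre by simp
  have \<omega>1: "\<omega> \<noteq> 1"
  proof
    assume "\<omega> = 1"
    then have "cos (2 * pi / 3) = 1" by (simp add: \<omega>_def complex_eq_iff)
    then show False by (simp add: cos_120)
  qed
  have "(\<omega> - 1) * (1 + \<omega> + \<omega>\<^sup>2) = \<omega> ^ 3 - 1" by (simp add: algebra_simps power2_eq_square power3_eq_cube)
  with \<omega>1 \<omega>3 have \<omega>0: "1 + \<omega> + \<omega>\<^sup>2 = 0" by simp
  have norm: "norm \<omega> = 1" by (simp add: \<omega>_def)
  define s where "s = (\<Sum>i<3. \<bar>z i - 1 / 3\<bar>)"
  define Z where "Z r = of_real (z 0) + \<omega> ^ r * of_real (z 1) + (\<omega> ^ r)\<^sup>2 * of_real (z 2)" for r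
  have Z_le: "norm (Z r) \<le> s" if "1 + \<omega> ^ r + (\<omega> ^ r)\<^sup>2 = 0" for r
  proof -
    have "Z r = of_real (z 0 - 1 / 3) + \<omega> ^ r * of_real (z 1 - 1 / 3) + (\<omega> ^ r)\<^sup>2 * of_real (z 2 - 1 / 3)
        + (1 + \<omega> ^ r + (\<omega> ^ r)\<^sup>2) / 3"
      by (simp add: Z_def algebra_simps add_divide_distrib)
    then have "Z r = of_real (z 0 - 1 / 3) + \<omega> ^ r * of_real (z 1 - 1 / 3) + (\<omega> ^ r)\<^sup>2 * of_real (z 2 - 1 / 3)"
      using that by simp
    also have "norm \<dots> \<le> norm (of_real (z 0 - 1 / 3) :: complex) + norm (\<omega> ^ r * of_real (z 1 - 1 / 3))
        + norm ((\<omega> ^ r)\<^sup>2 * of_real (z 2 - 1 / 3))"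
      by (intro order_trans[OF norm_triangle_ineq] add_mono norm_triangle_ineq order_refl)
    also have "\<dots> = s"
      by (simp only: norm_mult norm_power norm norm_of_real s_def sum_lessThan_3) simp
    finally show ?thesis .
  qed
  have "3 * complex_of_real (sum (column_weight z) (admissible k))
      = (\<Sum>v\<in>admissible k. 3 * of_real (column_weight z v))"
    by (simp add: sum_distrib_left)
  also have "\<dots> = (\<Sum>v\<in>compositions3 k. \<Sum>r<3. of_real (column_weight z v) * (\<omega> ^ r) ^ (v 1 + 2 * v 2))"
    unfolding sum_distrib_left[of "of_real _", symmetric] root_of_unity_filter[OF \<omega>3 \<omega>0] admissible_def
    by (rule sum.mono_neutral_cong_left) (auto simp: finite_compositions3)
  also have "\<dots> = (\<Sum>r<3. \<Sum>v\<in>compositions3 k. of_real (column_weight z v) * (\<omega> ^ r) ^ (v 1 + 2 * v 2))"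
    by (rule sum.swap)
  also have "\<dots> = (\<Sum>r<3. Z r ^ k)"
    unfolding Z_def
    by (subst trinomial[symmetric], intro sum.cong refl)
       (simp add: column_weight_def multinom_compositions3 prod_lessThan_3 power_add power_mult power_mult_distrib)
  finally have "3 * complex_of_real (sum (column_weight z) (admissible k)) = 1 + Z 1 ^ k + Z 2 ^ k"
    using z by (simp add: sum_lessThan_3 Z_def flip: of_real_add)
  then have "norm (3 * complex_of_real (sum (column_weight z) (admissible k))) \<le> norm (1::complex) + norm (Z 1 ^ k) + norm (Z 2 ^ k)"
    by (metis norm_triangle_ineq norm_triangle_le add_right_mono order_trans)
  also have "\<dots> \<le> 1 + s ^ k + s ^ k"
  proof (intro add_mono)
    show "norm (Z 1 ^ k) \<le> s ^ k"
      unfolding norm_power using \<omega>0 by (intro power_mono Z_le) auto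
    have "(\<omega>\<^sup>2)\<^sup>2 = \<omega> * \<omega> ^ 3" by (simp add: eval_nat_numeral)
    then show "norm (Z 2 ^ k) \<le> s ^ k"
      unfolding norm_power using \<omega>0 \<omega>3 by (intro power_mono Z_le) (auto simp: algebra_simps)
  qed auto
  finally have "\<bar>3 * sum (column_weight z) (admissible k)\<bar> \<le> 1 + s ^ k + s ^ k"
    by (metis norm_of_real of_real_mult of_real_numeral)
  then show ?thesis by (simp add: s_def)
qed

lemma sum_column_weight_le_one:
  assumes "\<And>i. 0 \<le> z i" "z 0 + z 1 + z 2 = 1"
  shows "sum (column_weight z) (admissible k) \<le> 1"
proof -
  have "sum (column_weight z) (admissible k) \<le> sum (column_weight z) (compositions3 k)"
    using assms by (intro sum_mono2 finite_compositions3) (auto simp: admissible_def column_weight_nonneg)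
  also have "\<dots> = (z 0 + z 1 + z 2) ^ k"
    by (subst trinomial[symmetric], intro sum.cong refl)
       (simp add: column_weight_def multinom_compositions3 prod_lessThan_3)
  finally show ?thesis using assms by simp
qed

text \<open>By Stirling the exponential factors cancel against the powers; of the square roots
  \<open>sqrt n\<close> remains in the numerator and the roots of the \<open>l i\<close>, each at
  most \<open>sqrt n\<close>, in the denominator.\<close>

lemma multinom_powers_ge:
  assumes l: "l \<in> compositions3 n" and pos: "\<And>i. i < 3 \<Longrightarrow> 1 \<le> l i"
  shows "1 / (exp 3 * real n) \<le> multinom {..<3} l * (\<Prod>i<3. (real (l i) / real n) ^ l i)"
proof -
  have sum: "(\<Sum>i<3. l i) = n" using l by (simp add: compositions3_def)
  have n: "n \<ge> 1" using pos[of 0] compositions3_sum[OF l] by linarith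
  have le_n: "l i \<le> n" if "i < 3" for i
    using that sum by (metis finite_lessThan lessThan_iff member_le_sum zero_le)
  define P where "P = (\<Prod>i<3. (real (l i) / exp 1) ^ l i)"
  have P: "P > 0" unfolding P_def using pos by (intro prod_pos) (auto simp: Suc_le_eq)
  have "(\<Prod>i<3. (real (l i) / real n) ^ l i) * (real n / exp 1) ^ n = P"
  proof -
    have "(real n / exp 1) ^ n = (\<Prod>i<3. (real n / exp 1) ^ l i)" by (simp add: power_sum[symmetric] sum)
    then show ?thesis
      using n by (simp add: P_def prod.distrib[symmetric] power_mult_distrib[symmetric])
  qed
  then have R: "(\<Prod>i<3. (real (l i) / real n) ^ l i) = P / (real n / exp 1) ^ n"
    using n by (simp add: field_simps)
  have "(\<Prod>i<3. fact (l i)) \<le> (\<Prod>i<3. exp 1 * sqrt (real n) * (real (l i) / exp 1) ^ l i)"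
  proof (intro prod_mono conjI)
    fix i :: nat assume i: "i \<in> {..<3}"
    have "fact (l i) \<le> exp 1 * sqrt (real (l i)) * (real (l i) / exp 1) ^ l i"
      using pos i by (intro fact_le_stirling) auto
    also have "\<dots> \<le> exp 1 * sqrt (real n) * (real (l i) / exp 1) ^ l i"
      using le_n i by (intro mult_right_mono mult_left_mono) auto
    finally show "fact (l i) \<le> exp 1 * sqrt (real n) * (real (l i) / exp 1) ^ l i" .
  qed simp
  also have "\<dots> = exp 3 * (real n * sqrt (real n)) * P"
  proof -
    have "(exp 1 :: real) ^ 3 = exp 3" by (simp flip: exp_of_nat_mult)
    moreover have "sqrt (real n) ^ 3 = real n * sqrt (real n)" by (simp add: power3_eq_cube)
    ultimately show ?thesis by (simp add: prod.distrib P_def power_mult_distrib)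
  qed
  finally have upper: "(\<Prod>i<3. fact (l i)) \<le> exp 3 * (real n * sqrt (real n)) * P" .
  have lower: "sqrt (real n) * (real n / exp 1) ^ n \<le> fact n" by (rule fact_ge_stirling[OF n])
  have "1 / (exp 3 * real n) = sqrt (real n) * (real n / exp 1) ^ n / (exp 3 * (real n * sqrt (real n)) * P) * (P / (real n / exp 1) ^ n)"
    using n P by (simp add: divide_simps)
  also have "\<dots> \<le> fact n / (\<Prod>i<3. fact (l i)) * (P / (real n / exp 1) ^ n)"
    using upper lower n P by (intro mult_right_mono frac_le prod_pos) auto
  also have "fact n / (\<Prod>i<3. fact (l i)) = multinom {..<3} l"
    by (simp add: multinom_def sum)
  finally show ?thesis by (simp only: R)
qed

text \<open>With \<open>z i = l i / (km)\<close>, the local bound for \<open>K\<close> and the lower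
  bound for \<open>multinom\<close> carry the same product of powers and the same order
  \<open>1/m\<close>; both cancel in the quotient.\<close>

lemma K_le_multinom:
  assumes k: "k \<ge> 3" and m: "m > 0"
    and l: "l \<in> compositions3 (k * m)" "\<And>i. i < 3 \<Longrightarrow> 1 / 6 \<le> real (l i) / real (k * m)"
    and s: "s = (\<Sum>i<3. \<bar>real (l i) / real (k * m) - 1 / 3\<bar>)"
  shows "K k m l \<le> 2 * 6 ^ k * exp 3 * real k * multinom {..<3} l * exp (2 * real m * s ^ k) / 3 ^ m"
proof -
  define z where "z i = real (l i) / real (k * m)" for i
  define q where "q = sum (column_weight z) (admissible k)"
  define Q where "Q = (\<Prod>i<3. z i ^ l i)"
  have sum: "z 0 + z 1 + z 2 = 1"
    using k m compositions3_sum[OF l(1)] unfolding z_def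
    by (simp add: add_divide_distrib[symmetric] flip: of_nat_add of_nat_mult)
  have z0: "0 \<le> z i" for i by (simp add: z_def)
  have q1: "q \<le> 1" unfolding q_def by (rule sum_column_weight_le_one[OF z0 sum])
  have q0: "0 \<le> q" unfolding q_def by (intro sum_nonneg column_weight_nonneg z0)
  have "0 < z i" if "i < 3" for i
    using l(2)[OF that] unfolding z_def by linarith
  then have Q: "Q > 0" unfolding Q_def by (intro prod_pos) auto
  have s': "s = (\<Sum>i<3. \<bar>z i - 1 / 3\<bar>)" by (simp add: s z_def)
  have pos: "1 \<le> l i" if "i < 3" for i
    using l(2)[OF that] by (cases "l i") auto
  have "3 * q \<le> 1 + 2 * s ^ k"
    using sum_column_weight_le[OF sum, of k, folded q_def s'] by (simp add: field_simps)
  also have "\<dots> \<le> exp (2 * s ^ k)" by (rule exp_ge_add_one_self)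
  finally have "3 * q \<le> exp (2 * s ^ k)" .
  then have "(3 * q) ^ m \<le> exp (2 * s ^ k) ^ m" using q0 by (intro power_mono) auto
  then have qm: "q ^ m \<le> exp (2 * real m * s ^ k) / 3 ^ m"
    by (simp add: power_mult_distrib field_simps exp_of_nat_mult[symmetric])
  have "K k m l * Q \<le> 2 * q ^ m / ((1 / 6) ^ k * real m)"
    unfolding Q_def using l(2)
    by (intro K_local_bound k m z0 q_def q1) (auto simp: z_def)
  also have "\<dots> = (2 * 6 ^ k * exp 3 * real k * q ^ m) * (1 / (exp 3 * real (k * m)))"
    using k m by (simp add: field_simps)
  also have "\<dots> \<le> (2 * 6 ^ k * exp 3 * real k * q ^ m) * (multinom {..<3} l * Q)"
    unfolding Q_def z_def using multinom_powers_ge[OF l(1) pos] q0 by (intro mult_left_mono) auto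
  finally have "K k m l * Q \<le> (2 * 6 ^ k * exp 3 * real k * multinom {..<3} l * q ^ m) * Q"
    by (simp add: ac_simps)
  then have "K k m l \<le> 2 * 6 ^ k * exp 3 * real k * multinom {..<3} l * q ^ m"
    using Q by (simp only: mult_le_cancel_right_pos)
  also have "\<dots> \<le> 2 * 6 ^ k * exp 3 * real k * multinom {..<3} l * (exp (2 * real m * s ^ k) / 3 ^ m)"
    using qm multinom_pos[of l] by (intro mult_left_mono) auto
  finally show ?thesis by simp
qed

section \<open>Exponential tilting of occupancy numbers\<close>

text \<open>The cutoff \<open>b\<close> is independent of \<open>m\<close>, so that the index set
  stays fixed while the induction lowers \<open>m\<close>.\<close>

lemma fps_nth_power_eq_sum_PiE:
  fixes f :: "real fps"
  assumes "m \<le> b"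
  shows "fps_nth (f ^ n) m =
    (\<Sum>v\<in>{..<n} \<rightarrow>\<^sub>E {..b}. if (\<Sum>i<n. v i) = m then \<Prod>i<n. fps_nth f (v i) else 0)"
  using assms
proof (induction n arbitrary: m)
  case 0
  then show ?case by auto
next
  case (Suc n)
  let ?P = "\<lambda>v. \<Prod>i<n. fps_nth f (v i)"
  have eq: "(\<Sum>i<n. (v(n := s)) i) = (\<Sum>i<n. v i)"
    "(\<Prod>i<n. fps_nth f ((v(n := s)) i)) = ?P v" for v s
    by (auto intro!: sum.cong prod.cong)
  have inner: "(\<Sum>v\<in>{..<n} \<rightarrow>\<^sub>E {..b}. if (\<Sum>i<n. v i) + s = m then ?P v * fps_nth f s else 0)
      = (if s \<le> m then fps_nth f s * fps_nth (f ^ n) (m - s) else 0)" for s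
  proof (cases "s \<le> m")
    case True
    have "(if (\<Sum>i<n. v i) + s = m then ?P v * fps_nth f s else 0)
        = fps_nth f s * (if (\<Sum>i<n. v i) = m - s then ?P v else 0)" for v
      using True by auto
    then show ?thesis using True Suc.prems by (simp only: sum_distrib_left[symmetric] if_True) (simp add: Suc.IH)
  qed auto
  have "(\<Sum>v\<in>{..<Suc n} \<rightarrow>\<^sub>E {..b}. if (\<Sum>i<Suc n. v i) = m then \<Prod>i<Suc n. fps_nth f (v i) else 0)
      = (\<Sum>s\<le>b. if s \<le> m then fps_nth f s * fps_nth (f ^ n) (m - s) else 0)"
    unfolding sum_PiE_lessThan_Suc[OF finite_atMost] sum.lessThan_Suc prod.lessThan_Suc eq fun_upd_same inner ..
  also have "\<dots> = (\<Sum>s\<le>m. fps_nth f s * fps_nth (f ^ n) (m - s))"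
    using Suc.prems by (intro sum.mono_neutral_cong_right) auto
  also have "\<dots> = fps_nth (f ^ Suc n) m"
    by (simp add: fps_mult_nth atLeast0AtMost)
  finally show ?case ..
qed

text \<open>The series \<open>e^z - 1 - z\<close>: exponential generating function of a box with at
  least two balls.\<close>

definition occ_fps :: "real fps" where
  "occ_fps = Abs_fps (\<lambda>j. if j < 2 then 0 else 1 / fact j)"

lemma M_eq_fps_nth: "M m n = fact m * fps_nth (occ_fps ^ n) m"
proof -
  have "M m n = (\<Sum>v\<in>{v \<in> {..<n} \<rightarrow>\<^sub>E {..m}. (\<Sum>i<n. v i) = m \<and> (\<forall>i<n. 2 \<le> v i)}. fact m * (\<Prod>i<n. fps_nth occ_fps (v i)))"
    unfolding M_def
  proof (rule sum.cong)
    have "v i \<le> m" if "(\<Sum>i<n. v i) = m" "i < n" for v i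
      using that member_le_sum[of i "{..<n}" v] by auto
    then show "occupancies m n = {v \<in> {..<n} \<rightarrow>\<^sub>E {..m}. (\<Sum>i<n. v i) = m \<and> (\<forall>i<n. 2 \<le> v i)}"
      by (auto simp: occupancies_def PiE_iff)
  next
    fix v assume "v \<in> {v \<in> {..<n} \<rightarrow>\<^sub>E {..m}. (\<Sum>i<n. v i) = m \<and> (\<forall>i<n. 2 \<le> v i)}"
    then have v: "(\<Sum>i<n. v i) = m" "\<And>i. i < n \<Longrightarrow> \<not> v i < 2" by auto
    then show "multinom {..<n} v = fact m * (\<Prod>i<n. fps_nth occ_fps (v i))"
      by (simp add: multinom_def occ_fps_def prod_dividef)
  qed
  also have "\<dots> = fact m * (\<Sum>v\<in>{..<n} \<rightarrow>\<^sub>E {..m}. if (\<Sum>i<n. v i) = m then \<Prod>i<n. fps_nth occ_fps (v i) else 0)"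
    unfolding sum_distrib_left[symmetric]
    by (intro arg_cong2[where f = "(*)"] refl sum.mono_neutral_cong_left finite_PiE)
       (auto simp: occ_fps_def not_less)
  finally show ?thesis using fps_nth_power_eq_sum_PiE[of m m occ_fps n] by simp
qed

section \<open>Coefficientwise comparison and growth of coefficients\<close>

lemma fps_mult_nth_mono:
  fixes f g :: "real fps"
  assumes "\<And>j. 0 \<le> fps_nth f j" "\<And>j. fps_nth f j \<le> fps_nth f' j"
    and "\<And>j. 0 \<le> fps_nth g j" "\<And>j. fps_nth g j \<le> fps_nth g' j"
  shows "fps_nth (f * g) j \<le> fps_nth (f' * g') j"
  unfolding fps_mult_nth using assms by (intro sum_mono mult_mono) (auto intro: order_trans)

lemma fps_mult_nth_nonneg:
  fixes f g :: "real fps"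
  shows "(\<And>j. 0 \<le> fps_nth f j) \<Longrightarrow> (\<And>j. 0 \<le> fps_nth g j) \<Longrightarrow> 0 \<le> fps_nth (f * g) j"
  unfolding fps_mult_nth by (intro sum_nonneg mult_nonneg_nonneg)

lemma fps_power_nth_nonneg:
  fixes f :: "real fps"
  assumes "\<And>j. 0 \<le> fps_nth f j"
  shows "0 \<le> fps_nth (f ^ n) j"
  by (induction n arbitrary: j) (auto intro: fps_mult_nth_nonneg assms)

lemma fps_power_nth_mono:
  fixes f :: "real fps"
  assumes "\<And>j. 0 \<le> fps_nth f j" "\<And>j. fps_nth f j \<le> fps_nth g j"
  shows "fps_nth (f ^ n) j \<le> fps_nth (g ^ n) j"
  by (induction n arbitrary: j) (auto intro: fps_mult_nth_mono fps_power_nth_nonneg assms)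

text \<open>The weights \<open>h j = j! \<cdot> [z^j] P\<close> of an occupancy number are increasing precisely if
  \<open>growing 1 P\<close>; a product of \<open>n\<close> such series has coefficients \<open>p\<close> with
  \<open>n \<cdot> p (j - 1) \<le> j \<cdot> p j\<close>.\<close>

definition growing :: "nat \<Rightarrow> real fps \<Rightarrow> bool" where
  "growing n P \<longleftrightarrow> (\<forall>j. 0 \<le> fps_nth P j \<and> real n * fps_nth P j \<le> fps_nth (fps_deriv P) j)"

text \<open>By the product rule the growth constants add up.\<close>

lemma growing_mult:
  assumes "growing a P" "growing b Q"
  shows "growing (a + b) (P * Q)"
  unfolding growing_def
proof (intro allI conjI)
  fix j
  show "0 \<le> fps_nth (P * Q) j" using assms by (auto simp: growing_def intro: fps_mult_nth_nonneg)
  have "real (a + b) * fps_nth (P * Q) j = fps_nth (P * (fps_const (real b) * Q)) j + fps_nth ((fps_const (real a) * P) * Q) j"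
    by (simp only: mult.left_commute[of P] mult.assoc[of "fps_const (real a)"] fps_mult_left_const_nth) (simp add: algebra_simps)
  also have "\<dots> \<le> fps_nth (P * fps_deriv Q) j + fps_nth (fps_deriv P * Q) j"
    using assms by (intro add_mono fps_mult_nth_mono) (auto simp: growing_def simp del: fps_deriv_nth)
  finally show "real (a + b) * fps_nth (P * Q) j \<le> fps_nth (fps_deriv (P * Q)) j"
    by (simp del: fps_deriv_nth)
qed

lemma growing_power:
  assumes "growing 1 P"
  shows "growing n (P ^ n)"
proof (induction n)
  case 0
  show ?case by (auto simp: growing_def)
next
  case (Suc n)
  then show ?case using growing_mult[OF assms Suc] by simp
qed

text \<open>Each step down from an index \<open>i + 1 \<le> k\<close> costs a factor
  \<open>(i+1)/n\<close>, which is at most \<open>r\<close>.\<close>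

lemma growing_nth_diff_le:
  assumes P: "growing n P" and "real k \<le> r * real n" "0 < n" "0 \<le> r"
  shows "d \<le> k \<Longrightarrow> fps_nth P (k - d) \<le> r ^ d * fps_nth P k"
proof (induction d)
  case (Suc d)
  define i where "i = k - Suc d"
  have i: "k - d = i + 1" "i + 1 \<le> k" using Suc.prems by (auto simp: i_def)
  have nn: "0 \<le> fps_nth P (i + 1)" using P by (simp add: growing_def)
  have "real n * fps_nth P i \<le> real (i + 1) * fps_nth P (i + 1)"
    using P by (simp add: growing_def)
  also have "\<dots> \<le> (r * real n) * fps_nth P (i + 1)"
    using i(2) assms(2) nn by (intro mult_right_mono) auto
  finally have "fps_nth P i \<le> r * fps_nth P (i + 1)"
    using assms(3) by (simp add: mult.assoc mult.left_commute[of r])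
  also have "\<dots> \<le> r * (r ^ d * fps_nth P k)"
    using Suc i assms(4) by (intro mult_left_mono) auto
  finally show ?case by (simp add: i_def)
qed simp

text \<open>The series \<open>2 (exp (e^2 z) - 1 - e^2 z)\<close>, which dominates the second-order
  effect of a tilt on one box.\<close>

definition tilt_fps :: "real fps" where
  "tilt_fps = Abs_fps (\<lambda>j. if j < 2 then 0 else 2 * exp 2 ^ j / fact j)"

text \<open>The weights are 0 for \<open>j < 2\<close> and \<open>1 + 2\<tau> e^(2j)\<close> from
  there on, so they increase.\<close>

lemma growing_occ_tilt:
  assumes "0 \<le> \<tau>"
  shows "growing 1 (occ_fps + fps_const \<tau> * tilt_fps)"
  unfolding growing_def
proof (intro allI conjI)
  fix j
  show "0 \<le> fps_nth (occ_fps + fps_const \<tau> * tilt_fps) j"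
    using assms by (simp add: occ_fps_def tilt_fps_def)
  have "exp 2 ^ j \<le> (exp 2 ^ Suc j :: real)" by (intro power_increasing) auto
  then have "\<tau> * (2 * exp 2 ^ j / fact j) \<le> \<tau> * (2 * exp 2 ^ Suc j / fact j)"
    using assms by (intro mult_left_mono divide_right_mono) auto
  moreover have key: "real (j + 1) * (x / fact (j + 1)) = x / fact j" for x :: real
    unfolding Suc_eq_plus1[symmetric] fact_Suc by (simp del: of_nat_Suc)
  then have "fps_nth (fps_deriv (occ_fps + fps_const \<tau> * tilt_fps)) j =
      (if j = 0 then 0 else 1 / fact j + \<tau> * (2 * exp 2 ^ Suc j / fact j))"
    using key[of 1] by (simp add: occ_fps_def tilt_fps_def distrib_left mult.left_commute[of _ \<tau>] del: fact_Suc of_nat_Suc)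
  ultimately show "real 1 * fps_nth (occ_fps + fps_const \<tau> * tilt_fps) j
      \<le> fps_nth (fps_deriv (occ_fps + fps_const \<tau> * tilt_fps)) j"
    using assms by (auto simp: occ_fps_def tilt_fps_def simp del: fps_deriv_nth)
qed

lemma sum_power_div_fact_le_exp:
  fixes x :: real
  assumes "0 \<le> x"
  shows "(\<Sum>j\<le>k. x ^ j / fact j) \<le> exp x"
proof -
  have "(\<Sum>j\<in>{..k}. x ^ j /\<^sub>R fact j) \<le> (\<Sum>j. x ^ j /\<^sub>R fact j)"
    using assms by (intro sum_le_suminf summable_exp_generic) auto
  then show ?thesis by (simp add: exp_def divide_inverse mult.commute)
qed

text \<open>Both coefficients are compared with \<open>p\<close>, the coefficient of
  \<open>P\<close> at \<open>k - 2\<close>: the term \<open>z^2/2\<close> alone gives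
  \<open>P * occ_fps\<close> at least \<open>p/2\<close>, while growth bounds the tilted convolution
  by \<open>2p\<close> times an exponential series.\<close>

lemma fps_mult_tilt_le:
  assumes P: "growing n P" and r: "real k \<le> r * real n" "0 < n" "1 \<le> r"
  shows "fps_nth (P * tilt_fps) k \<le> 4 * exp (exp 2 * r) * fps_nth (P * occ_fps) k"
proof (cases "k < 2")
  case True
  then have "fps_nth (P * tilt_fps) k = 0" "fps_nth (P * occ_fps) k = 0"
    by (auto simp: fps_mult_nth tilt_fps_def occ_fps_def intro!: sum.neutral)
  then show ?thesis by simp
next
  case False
  define p where "p = fps_nth P (k - 2)"
  have nn: "0 \<le> fps_nth P j" for j using P by (simp add: growing_def)
  have "fps_nth (P * tilt_fps) k = (\<Sum>j\<le>k. fps_nth tilt_fps j * fps_nth P (k - j))"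
    by (subst mult.commute) (simp add: fps_mult_nth atLeast0AtMost)
  also have "\<dots> \<le> (\<Sum>j\<le>k. 2 * ((exp 2 * r) ^ j / fact j) * p)"
  proof (intro sum_mono)
    fix j assume j: "j \<in> {..k}"
    show "fps_nth tilt_fps j * fps_nth P (k - j) \<le> 2 * ((exp 2 * r) ^ j / fact j) * p"
    proof (cases "j < 2")
      case True
      then show ?thesis using r nn by (auto simp: tilt_fps_def p_def intro!: mult_nonneg_nonneg divide_nonneg_nonneg)
    next
      case False
      have "fps_nth P (k - 2 - (j - 2)) \<le> r ^ (j - 2) * p"
        unfolding p_def using r False j by (intro growing_nth_diff_le[OF P]) auto
      also have "\<dots> \<le> r ^ j * p"
        using r nn by (intro mult_right_mono power_increasing) (auto simp: p_def)
      also have "k - 2 - (j - 2) = k - j" using False by linarith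
      finally have "fps_nth P (k - j) \<le> r ^ j * p" .
      then have "2 * exp 2 ^ j / fact j * fps_nth P (k - j) \<le> 2 * exp 2 ^ j / fact j * (r ^ j * p)"
        by (intro mult_left_mono) auto
      then show ?thesis using False by (simp add: tilt_fps_def power_mult_distrib)
    qed
  qed
  also have "\<dots> = 2 * p * (\<Sum>j\<le>k. (exp 2 * r) ^ j / fact j)"
    by (simp add: sum_distrib_left ac_simps)
  also have "\<dots> \<le> 2 * p * exp (exp 2 * r)"
    using r nn by (intro mult_left_mono sum_power_div_fact_le_exp) (auto simp: p_def)
  finally have 1: "fps_nth (P * tilt_fps) k \<le> 2 * p * exp (exp 2 * r)" .
  have "fps_nth P (k - 2) * fps_nth occ_fps (k - (k - 2)) \<le> fps_nth (P * occ_fps) k"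
    unfolding fps_mult_nth
    by (rule member_le_sum[where f = "\<lambda>i. fps_nth P i * fps_nth occ_fps (k - i)"])
       (use nn in \<open>auto simp: occ_fps_def\<close>)
  then have "p / 2 \<le> fps_nth (P * occ_fps) k"
    using False by (simp add: p_def occ_fps_def)
  then have "4 * exp (exp 2 * r) * (p / 2) \<le> 4 * exp (exp 2 * r) * fps_nth (P * occ_fps) k"
    by (intro mult_left_mono) auto
  moreover have "4 * exp (exp 2 * r) * (p / 2) = 2 * p * exp (exp 2 * r)" by simp
  ultimately show ?thesis using 1 by linarith
qed

text \<open>Tilted factors are replaced one by one. At each exchange the other \<open>n - 1\<close>
  factors form a growing series, which explains \<open>n - 1\<close> in the hypothesis on
  \<open>r\<close>.\<close>

lemma fps_power_tilt_le:
  assumes \<tau>: "0 \<le> \<tau>" and n: "2 \<le> n" and r: "real k \<le> r * real (n - 1)" "1 \<le> r"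
  shows "fps_nth ((occ_fps + fps_const \<tau> * tilt_fps) ^ n) k
    \<le> (1 + \<tau> * (4 * exp (exp 2 * r))) ^ n * fps_nth (occ_fps ^ n) k"
proof -
  let ?\<phi> = "occ_fps + fps_const \<tau> * tilt_fps" and ?B = "4 * exp (exp 2 * r)"
  have "fps_nth (occ_fps ^ a * ?\<phi> ^ b) k \<le> (1 + \<tau> * ?B) ^ b * fps_nth (occ_fps ^ n) k"
    if "a + b = n" for a b
    using that
  proof (induction b arbitrary: a)
    case (Suc b)
    define P where "P = occ_fps ^ a * ?\<phi> ^ b"
    have "growing (a + b) P"
      unfolding P_def using growing_occ_tilt[of 0] growing_occ_tilt[OF \<tau>]
      by (intro growing_mult growing_power) auto
    then have P: "growing (n - 1) P" using Suc.prems by (metis add_Suc_right diff_Suc_1)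
    have "occ_fps ^ a * ?\<phi> ^ Suc b = P * occ_fps + fps_const \<tau> * (P * tilt_fps)"
      by (simp add: P_def algebra_simps)
    then have "fps_nth (occ_fps ^ a * ?\<phi> ^ Suc b) k = fps_nth (P * occ_fps) k + \<tau> * fps_nth (P * tilt_fps) k"
      by simp
    also have "\<dots> \<le> fps_nth (P * occ_fps) k + \<tau> * (?B * fps_nth (P * occ_fps) k)"
      using \<tau> n r by (intro add_left_mono mult_left_mono fps_mult_tilt_le[OF P]) auto
    also have "\<dots> = (1 + \<tau> * ?B) * fps_nth (occ_fps ^ Suc a * ?\<phi> ^ b) k"
      by (simp add: P_def algebra_simps)
    also have "\<dots> \<le> (1 + \<tau> * ?B) * ((1 + \<tau> * ?B) ^ b * fps_nth (occ_fps ^ n) k)"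
      using \<tau> Suc.prems by (intro mult_left_mono Suc.IH) auto
    finally show ?case by simp
  qed simp
  from this[of 0 n] show ?thesis by simp
qed

section \<open>Placements of balls in coloured boxes\<close>

definition scaled_occ_fps :: "real \<Rightarrow> real fps" where
  "scaled_occ_fps x = Abs_fps (\<lambda>j. x ^ j * fps_nth occ_fps j)"

lemma scaled_occ_fps_power_nth:
  "fps_nth (scaled_occ_fps x ^ n) j = x ^ j * M j n / fact j"
proof -
  have "scaled_occ_fps x ^ n = (occ_fps oo (fps_const x * fps_X)) ^ n"
    by (simp add: scaled_occ_fps_def fps_compose_linear)
  also have "\<dots> = occ_fps ^ n oo (fps_const x * fps_X)"
    by (rule fps_compose_power) simp
  finally show ?thesis by (simp add: fps_compose_linear M_eq_fps_nth)
qed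

lemma M_nonneg: "0 \<le> M m n"
  unfolding M_def multinom_def by (intro sum_nonneg divide_nonneg_nonneg prod_nonneg) auto

lemma fps_mult3_nth:
  fixes a b c :: "real fps"
  shows "fps_nth (a * b * c) n = (\<Sum>l\<in>compositions3 n. fps_nth a (l 0) * fps_nth b (l 1) * fps_nth c (l 2))"
proof -
  have "fps_nth (a * (b * c)) n = (\<Sum>i\<le>n. \<Sum>j\<le>n - i. fps_nth a i * fps_nth b j * fps_nth c (n - i - j))"
    by (simp add: fps_mult_nth atLeast0AtMost sum_distrib_left mult.assoc)
  then show ?thesis
    using sum_compositions3[of "\<lambda>i j k. fps_nth a i * fps_nth b j * fps_nth c k" n] by (simp add: mult.assoc)
qed

text \<open>Counts placements of labelled balls in \<open>n\<close> boxes, at least two in each,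
  with a colouring of the boxes for which \<open>l i\<close> balls get colour \<open>i\<close>; the
  numbers \<open>w\<close> of boxes per colour are summed out.\<close>

definition colourings :: "nat \<Rightarrow> (nat \<Rightarrow> nat) \<Rightarrow> real" where
  "colourings n l = (\<Sum>w\<in>compositions3 n. multinom {..<3} w * multinom {..<3} l * (\<Prod>i<3. M (l i) (w i)))"

lemma colourings_nonneg: "0 \<le> colourings n l"
  unfolding colourings_def
  by (intro sum_nonneg mult_nonneg_nonneg prod_nonneg less_imp_le[OF multinom_pos] M_nonneg)


text \<open>When each ball of colour \<open>i\<close> has weight \<open>x i\<close>, every box
  independently contributes the sum of the three scaled series.\<close>

lemma sum_colourings:
  "(\<Sum>l\<in>compositions3 s. colourings n l * (\<Prod>i<3. x i ^ l i))
    = fact s * fps_nth ((scaled_occ_fps (x 0) + scaled_occ_fps (x 1) + scaled_occ_fps (x 2)) ^ n) s"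
proof -
  let ?F = "\<lambda>i w. scaled_occ_fps (x i) ^ w i"
  have "colourings n l * (\<Prod>i<3. x i ^ l i) = fact s * (\<Sum>w\<in>compositions3 n.
      multinom {..<3} w * (fps_nth (?F 0 w) (l 0) * fps_nth (?F 1 w) (l 1) * fps_nth (?F 2 w) (l 2)))"
    if "l \<in> compositions3 s" for l
  proof -
    have "multinom {..<3} l = fact s / (fact (l 0) * fact (l 1) * fact (l 2))"
      using compositions3_sum[OF that] by (simp add: multinom_def sum_lessThan_3 prod_lessThan_3)
    then show ?thesis
      unfolding colourings_def sum_distrib_right sum_distrib_left scaled_occ_fps_power_nth prod_lessThan_3
      by (intro sum.cong refl) (simp add: ac_simps)
  qed
  then have "(\<Sum>l\<in>compositions3 s. colourings n l * (\<Prod>i<3. x i ^ l i))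
      = fact s * (\<Sum>l\<in>compositions3 s. \<Sum>w\<in>compositions3 n.
          multinom {..<3} w * (fps_nth (?F 0 w) (l 0) * fps_nth (?F 1 w) (l 1) * fps_nth (?F 2 w) (l 2)))"
    by (simp add: sum_distrib_left)
  also have "\<dots> = fact s * (\<Sum>w\<in>compositions3 n. multinom {..<3} w * fps_nth (?F 0 w * ?F 1 w * ?F 2 w) s)"
    unfolding fps_mult3_nth sum_distrib_left[of "multinom _ _"] by (subst sum.swap) (rule refl)
  also have "(\<Sum>w\<in>compositions3 n. multinom {..<3} w * fps_nth (?F 0 w * ?F 1 w * ?F 2 w) s)
      = fps_nth (\<Sum>w\<in>compositions3 n. of_nat ((n choose w 0) * ((n - w 0) choose w 1)) * ?F 0 w * ?F 1 w * ?F 2 w) s"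
    unfolding fps_sum_nth
    by (intro sum.cong refl) (simp only: multinom_compositions3 mult.assoc fps_of_nat[symmetric] fps_mult_left_const_nth)
  finally show ?thesis by (simp only: trinomial)
qed

text \<open>The rates \<open>2/3\<close>, \<open>-1/3\<close>, \<open>-1/3\<close> add up to zero,
  so the linear terms cancel; the square of \<open>j\<close> in the remainder is absorbed by a
  second factor \<open>e^j\<close>.\<close>

lemma tilted_exp_sum_le:
  fixes t :: real
  assumes t: "\<bar>t\<bar> \<le> 1"
  shows "exp (2 * t / 3) ^ j + 2 * exp (- t / 3) ^ j \<le> 3 * (1 + t\<^sup>2 * (2 * exp 2 ^ j))"
proof -
  define u where "u = \<bar>t\<bar> * real j"
  have u: "0 \<le> u" "u \<le> real j" using t by (auto simp: u_def mult_left_le_one_le)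
  have *: "exp (a * (t * real j)) \<le> 1 + a * (t * real j) + u\<^sup>2 * exp (real j)" if a: "\<bar>a\<bar> \<le> 1" for a
  proof -
    have abs: "\<bar>a * (t * real j)\<bar> = \<bar>a\<bar> * u" by (simp add: abs_mult u_def)
    have le: "\<bar>a\<bar> * u \<le> u" using a u(1) by (simp add: mult_left_le_one_le)
    have "(a * (t * real j))\<^sup>2 \<le> u\<^sup>2"
      using le abs u(1) by (intro abs_le_square_iff[THEN iffD1]) simp
    then have "(a * (t * real j))\<^sup>2 * exp \<bar>a * (t * real j)\<bar> \<le> u\<^sup>2 * exp (real j)"
      using le abs u by (intro mult_mono) auto
    then show ?thesis using exp_le_quadratic[of "a * (t * real j)"] by linarith
  qed
  have j2: "(real j)\<^sup>2 \<le> 2 * exp (real j)"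
    using exp_lower_Taylor_quadratic[of "real j"] by simp
  have "exp (2 * t / 3) ^ j + 2 * exp (- t / 3) ^ j = exp (2 / 3 * (t * real j)) + 2 * exp (- (1 / 3) * (t * real j))"
    by (simp add: exp_of_nat_mult[symmetric] ac_simps)
  also have "\<dots> \<le> 3 + 3 * (u\<^sup>2 * exp (real j))"
    using *[of "2 / 3"] *[of "- (1 / 3)"] by simp
  finally have 1: "exp (2 * t / 3) ^ j + 2 * exp (- t / 3) ^ j \<le> 3 + 3 * (u\<^sup>2 * exp (real j))" .
  have "u\<^sup>2 * exp (real j) \<le> t\<^sup>2 * (2 * exp (real j)) * exp (real j)"
    unfolding u_def power_mult_distrib power2_abs using j2 by (intro mult_right_mono mult_left_mono) auto
  also have "\<dots> = t\<^sup>2 * (2 * exp 2 ^ j)"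
    by (simp add: exp_of_nat_mult[symmetric] exp_add[symmetric] mult_2_right flip: mult.assoc)
  finally show ?thesis using 1 by simp
qed


text \<open>Weights \<open>exp (2t/3)\<close> for colour \<open>i\<close> and
  \<open>exp (-t/3)\<close> for the others realise the tilt, since \<open>l\<close> has sum
  \<open>s\<close>. Box by box the tilted series is dominated by \<open>3 \<phi>\<close>, and
  \<open>fps_power_tilt_le\<close> returns from \<open>\<phi>\<close> to
  \<open>occ_fps\<close>.\<close>

lemma sum_colourings_tilted_le:
  fixes t r :: real
  assumes t: "\<bar>t\<bar> \<le> 1" and n: "2 \<le> n" and r: "real s \<le> r * real (n - 1)" "1 \<le> r" and i: "i < 3"
  shows "(\<Sum>l\<in>compositions3 s. colourings n l * exp (t * (real (l i) - real s / 3)))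
    \<le> 3 ^ n * exp (4 * exp (exp 2 * r) * t\<^sup>2 * real n) * M s n"
proof -
  define x where "x j = (if j = i then exp (2 * t / 3) else exp (- t / 3))" for j :: nat
  define \<phi> where "\<phi> = occ_fps + fps_const (t\<^sup>2) * tilt_fps"
  let ?B = "4 * exp (exp 2 * r)"
  have i3: "i = 0 \<or> i = 1 \<or> i = 2" using i by auto
  have occ0: "0 \<le> fps_nth occ_fps j" for j by (simp add: occ_fps_def)
  have x0: "0 \<le> x j" for j by (simp add: x_def)
  have x_sum: "x 0 ^ j + x 1 ^ j + x 2 ^ j = exp (2 * t / 3) ^ j + 2 * exp (- t / 3) ^ j" for j
    using i3 by (auto simp: x_def)
  have x_prod: "(\<Prod>j<3. x j ^ l j) = exp (t * (real (l i) - real s / 3))" if l: "l \<in> compositions3 s" for l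
  proof -
    have s: "real s = real (l 0) + real (l 1) + real (l 2)"
      using compositions3_sum[OF l] by (metis of_nat_add)
    show ?thesis
      using i3 unfolding s
      by (auto simp: prod_lessThan_3 x_def exp_of_nat_mult[symmetric] exp_add[symmetric] algebra_simps add_divide_distrib)
  qed
  have "(\<Sum>l\<in>compositions3 s. colourings n l * exp (t * (real (l i) - real s / 3)))
      = (\<Sum>l\<in>compositions3 s. colourings n l * (\<Prod>j<3. x j ^ l j))"
    by (intro sum.cong refl) (simp add: x_prod)
  also have "\<dots> = fact s * fps_nth ((scaled_occ_fps (x 0) + scaled_occ_fps (x 1) + scaled_occ_fps (x 2)) ^ n) s"
    by (rule sum_colourings)
  also have "\<dots> \<le> fact s * fps_nth ((fps_const 3 * \<phi>) ^ n) s"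
  proof (intro mult_left_mono fps_power_nth_mono)
    fix j
    show "0 \<le> fps_nth (scaled_occ_fps (x 0) + scaled_occ_fps (x 1) + scaled_occ_fps (x 2)) j"
      using occ0 x0 by (simp add: scaled_occ_fps_def)
    have "fps_nth (scaled_occ_fps (x 0) + scaled_occ_fps (x 1) + scaled_occ_fps (x 2)) j
        = (x 0 ^ j + x 1 ^ j + x 2 ^ j) * fps_nth occ_fps j"
      by (simp add: scaled_occ_fps_def algebra_simps)
    also have "\<dots> \<le> (3 * (1 + t\<^sup>2 * (2 * exp 2 ^ j))) * fps_nth occ_fps j"
      unfolding x_sum by (intro mult_right_mono tilted_exp_sum_le t occ0)
    also have "\<dots> = fps_nth (fps_const 3 * \<phi>) j"
      by (simp add: \<phi>_def occ_fps_def tilt_fps_def field_simps)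
    finally show "fps_nth (scaled_occ_fps (x 0) + scaled_occ_fps (x 1) + scaled_occ_fps (x 2)) j
      \<le> fps_nth (fps_const 3 * \<phi>) j" .
  qed simp
  also have "fps_nth ((fps_const 3 * \<phi>) ^ n) s = 3 ^ n * fps_nth (\<phi> ^ n) s"
    by (simp add: power_mult_distrib fps_const_power)
  also have "fact s * (3 ^ n * fps_nth (\<phi> ^ n) s) \<le> fact s * (3 ^ n * ((1 + t\<^sup>2 * ?B) ^ n * fps_nth (occ_fps ^ n) s))"
    unfolding \<phi>_def using n r by (intro mult_left_mono fps_power_tilt_le) auto
  also have "\<dots> = 3 ^ n * ((1 + t\<^sup>2 * ?B) ^ n * M s n)"
    by (simp add: M_eq_fps_nth)
  also have "\<dots> \<le> 3 ^ n * (exp (t\<^sup>2 * ?B) ^ n * M s n)"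
    by (intro mult_left_mono mult_right_mono power_mono M_nonneg exp_ge_add_one_self add_nonneg_nonneg) auto
  also have "exp (t\<^sup>2 * ?B) ^ n = exp (?B * t\<^sup>2 * real n)"
    by (simp add: exp_of_nat_mult[symmetric] ac_simps)
  finally show ?thesis by (simp add: mult.assoc)
qed

section \<open>Summation over the central region\<close>

text \<open>If \<open>i\<close> is the integer part of \<open>\<bar>y\<bar>\<close> and
  \<open>\<sigma>\<close> the sign of \<open>y\<close>, the tangent to the square at
  \<open>\<sigma> i\<close> is within 1 of it at \<open>y\<close>. The other summands are positive
  and make the bound uniform in \<open>y\<close>.\<close>

lemma exp_square_le_sum:
  fixes \<eta> y l :: real
  assumes "0 \<le> \<eta>" "\<bar>y\<bar> \<le> l"
  shows "exp (\<eta> * y\<^sup>2) \<le> exp \<eta> * (\<Sum>i\<le>nat \<lfloor>l\<rfloor>. \<Sum>\<sigma>\<in>{1, -1}. exp (\<eta> * (2 * \<sigma> * real i * y - (real i)\<^sup>2)))"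
    (is "_ \<le> _ * (\<Sum>i\<le>_. ?f i)")
proof -
  define i where "i = nat \<lfloor>\<bar>y\<bar>\<rfloor>"
  define \<sigma> :: real where "\<sigma> = (if 0 \<le> y then 1 else -1)"
  have i: "real i \<le> \<bar>y\<bar>" "\<bar>y\<bar> < real i + 1" unfolding i_def by linarith+
  have "i \<le> nat \<lfloor>l\<rfloor>" unfolding i_def using assms by (intro nat_mono floor_mono)
  have "(\<bar>y\<bar> - real i)\<^sup>2 \<le> 1" using i by (intro power_le_one) auto
  then have "y\<^sup>2 \<le> 1 + (2 * \<sigma> * real i * y - (real i)\<^sup>2)"
    by (auto simp: \<sigma>_def power2_eq_square algebra_simps abs_if split: if_splits)
  then have "exp (\<eta> * y\<^sup>2) \<le> exp (\<eta> * (1 + (2 * \<sigma> * real i * y - (real i)\<^sup>2)))"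
    using assms by (simp add: mult_left_mono)
  also have "\<dots> = exp \<eta> * exp (\<eta> * (2 * \<sigma> * real i * y - (real i)\<^sup>2))"
    by (simp add: distrib_left exp_add)
  also have "\<dots> \<le> exp \<eta> * ?f i"
    by (intro mult_left_mono member_le_sum[where f = "\<lambda>\<sigma>. exp (\<eta> * (2 * \<sigma> * real i * y - (real i)\<^sup>2))"])
       (auto simp: \<sigma>_def)
  also have "\<dots> \<le> exp \<eta> * (\<Sum>i\<le>nat \<lfloor>l\<rfloor>. ?f i)"
    using \<open>i \<le> nat \<lfloor>l\<rfloor>\<close> by (intro mult_left_mono member_le_sum[where f = ?f]) (auto intro!: sum_nonneg)
  finally show ?thesis .
qed

text \<open>The square in the exponent is linearised by the previous lemma; the range of tilts is
  bounded because \<open>l i\<close> deviates from its mean by at most a constant multiple of \<open>n\<close>.\<close>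

lemma sum_colourings_gauss_le:
  fixes r \<eta> \<delta> :: real
  assumes n: "2 \<le> n" and r: "real s \<le> r * real (n - 1)" "1 \<le> r" and i: "i < 3"
    and \<eta>: "0 < \<eta>" "32 * exp (exp 2 * r) * \<eta> \<le> 1" "2 * \<eta> * \<delta> \<le> 1"
    and A: "A \<subseteq> compositions3 s" "\<And>l. l \<in> A \<Longrightarrow> \<bar>real (l i) - real s / 3\<bar> \<le> \<delta> * real n"
  shows "(\<Sum>l\<in>A. colourings n l * exp (\<eta> * (real (l i) - real s / 3)\<^sup>2 / real n))
    \<le> exp \<eta> * (2 / (1 - exp (- \<eta> / 2))) * 3 ^ n * M s n"
proof -
  define Y where "Y l = real (l i) - real s / 3" for l :: "nat \<Rightarrow> nat"
  define I where "I = nat \<lfloor>\<delta> * sqrt (real n)\<rfloor>"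
  define q where "q = exp (- \<eta> / 2)"
  define E where "E j \<sigma> = (\<Sum>l\<in>compositions3 s. colourings n l * exp (\<eta> * (2 * \<sigma> * real j * (Y l / sqrt (real n)) - (real j)\<^sup>2)))" for j :: nat and \<sigma> :: real
  have q: "0 < q" "q < 1" using \<eta> by (auto simp: q_def)
  have sn: "sqrt (real n) > 0" using n by simp
  have E: "E j \<sigma> \<le> 3 ^ n * M s n * q ^ j" if j: "j \<le> I" and \<sigma>: "\<sigma> \<in> {1, -1}" for j \<sigma>
  proof -
    \<comment> \<open>The tilt belonging to tangent point \<open>j\<close>;
      \<open>j \<le> \<delta> sqrt n\<close> and \<open>2 \<eta> \<delta> \<le> 1\<close> keep it
      within \<open>[-1, 1]\<close>.\<close>
    define t where "t = 2 * \<eta> * \<sigma> * real j / sqrt (real n)"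
    have t: "\<bar>t\<bar> \<le> 1"
    proof (cases "j = 0")
      case False
      then have "real j \<le> \<delta> * sqrt (real n)" using j unfolding I_def by linarith
      then have "2 * \<eta> * real j / sqrt (real n) \<le> 2 * \<eta> * (\<delta> * sqrt (real n)) / sqrt (real n)"
        using \<eta> sn by (intro divide_right_mono mult_left_mono) auto
      also have "\<dots> \<le> 1" using \<eta>(3) sn by (simp add: mult.assoc)
      finally show ?thesis using \<sigma> \<eta>(1) by (auto simp: t_def abs_mult)
    qed (simp add: t_def)
    have \<sigma>2: "\<sigma>\<^sup>2 = 1" using \<sigma> by auto
    have t2: "t\<^sup>2 * real n = 4 * \<eta>\<^sup>2 * (real j)\<^sup>2"
      using n by (simp add: t_def power_mult_distrib power_divide \<sigma>2)
    have "E j \<sigma> = exp (- (\<eta> * (real j)\<^sup>2)) * (\<Sum>l\<in>compositions3 s. colourings n l * exp (t * Y l))"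
    proof -
      have "exp (\<eta> * (2 * \<sigma> * real j * (Y l / sqrt (real n)) - (real j)\<^sup>2)) = exp (- (\<eta> * (real j)\<^sup>2)) * exp (t * Y l)" for l
        by (simp add: t_def exp_add[symmetric] algebra_simps)
      then show ?thesis by (simp add: E_def sum_distrib_left mult.left_commute)
    qed
    also have "\<dots> \<le> exp (- (\<eta> * (real j)\<^sup>2)) * (3 ^ n * exp (4 * exp (exp 2 * r) * t\<^sup>2 * real n) * M s n)"
      unfolding Y_def by (intro mult_left_mono sum_colourings_tilted_le t n r i) auto
    also have "\<dots> = 3 ^ n * M s n * exp (- (\<eta> * (real j)\<^sup>2) + 4 * exp (exp 2 * r) * (t\<^sup>2 * real n))"
      unfolding exp_add by (simp add: ac_simps)
    also have "\<dots> \<le> 3 ^ n * M s n * q ^ j"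
    proof (intro mult_left_mono mult_nonneg_nonneg M_nonneg)
      \<comment> \<open>For small \<open>\<eta>\<close> the cost of the tilt uses up at most half of
        the Gaussian decay \<open>\<eta> j^2\<close>; the other half yields a geometric series
        because \<open>j \<le> j^2\<close>.\<close>
      have "4 * exp (exp 2 * r) * (t\<^sup>2 * real n) = 32 * exp (exp 2 * r) * \<eta> * (\<eta> * (real j)\<^sup>2 / 2)"
        unfolding t2 by (simp add: power2_eq_square)
      also have "\<dots> \<le> 1 * (\<eta> * (real j)\<^sup>2 / 2)"
        using \<eta> by (intro mult_right_mono) auto
      finally have "- (\<eta> * (real j)\<^sup>2) + 4 * exp (exp 2 * r) * (t\<^sup>2 * real n) \<le> - (\<eta> / 2) * (real j)\<^sup>2" by simp
      also have "real j * 1 \<le> real j * real j" by (cases j) (auto intro: mult_left_mono)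
      then have "- (\<eta> / 2) * (real j)\<^sup>2 \<le> - (\<eta> / 2) * real j"
        using \<eta> by (simp add: power2_eq_square)
      finally show "exp (- (\<eta> * (real j)\<^sup>2) + 4 * exp (exp 2 * r) * (t\<^sup>2 * real n)) \<le> q ^ j"
        by (simp add: q_def exp_of_nat_mult[symmetric] mult.commute)
    qed auto
    finally show ?thesis .
  qed
  have "(\<Sum>l\<in>A. colourings n l * exp (\<eta> * (Y l)\<^sup>2 / real n))
      \<le> (\<Sum>l\<in>A. colourings n l * (exp \<eta> * (\<Sum>j\<le>I. \<Sum>\<sigma>\<in>{1, -1}. exp (\<eta> * (2 * \<sigma> * real j * (Y l / sqrt (real n)) - (real j)\<^sup>2)))))"
  proof (intro sum_mono mult_left_mono colourings_nonneg)
    fix l assume "l \<in> A"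
    then have "\<bar>Y l\<bar> \<le> \<delta> * sqrt (real n) * sqrt (real n)" using A(2) by (simp add: Y_def mult.assoc)
    then have "\<bar>Y l / sqrt (real n)\<bar> \<le> \<delta> * sqrt (real n)"
      using sn by (simp add: abs_divide pos_divide_le_eq)
    from exp_square_le_sum[OF less_imp_le[OF \<eta>(1)] this]
    show "exp (\<eta> * (Y l)\<^sup>2 / real n) \<le> exp \<eta> * (\<Sum>j\<le>I. \<Sum>\<sigma>\<in>{1, -1}. exp (\<eta> * (2 * \<sigma> * real j * (Y l / sqrt (real n)) - (real j)\<^sup>2)))"
      by (simp only: I_def power_divide real_sqrt_pow2 of_nat_0_le_iff times_divide_eq_right)
  qed
  also have "\<dots> \<le> (\<Sum>l\<in>compositions3 s. colourings n l * (exp \<eta> * (\<Sum>j\<le>I. \<Sum>\<sigma>\<in>{1, -1}. exp (\<eta> * (2 * \<sigma> * real j * (Y l / sqrt (real n)) - (real j)\<^sup>2)))))"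
    by (intro sum_mono2 finite_compositions3 A(1) mult_nonneg_nonneg colourings_nonneg sum_nonneg) auto
  also have "\<dots> = exp \<eta> * (\<Sum>j\<le>I. \<Sum>\<sigma>\<in>{1, -1}. E j \<sigma>)"
    unfolding E_def
    by (subst (2) sum.swap, subst sum.swap) (simp only: sum_distrib_left mult.left_commute[of "colourings _ _" "exp \<eta>"])
  also have "\<dots> \<le> exp \<eta> * (\<Sum>j\<le>I. \<Sum>\<sigma>\<in>{1::real, -1}. 3 ^ n * M s n * q ^ j)"
    using E by (intro mult_left_mono sum_mono) auto
  also have "\<dots> = exp \<eta> * (2 * (\<Sum>j\<le>I. q ^ j)) * 3 ^ n * M s n"
    by (simp add: sum_distrib_left sum_distrib_right ac_simps)
  also have "\<dots> \<le> exp \<eta> * (2 * (1 / (1 - q))) * 3 ^ n * M s n"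
  proof (intro mult_left_mono mult_right_mono M_nonneg)
    have "(\<Sum>j\<le>I. q ^ j) \<le> (\<Sum>j. q ^ j)"
      using q by (intro sum_le_suminf summable_geometric) auto
    then show "(\<Sum>j\<le>I. q ^ j) \<le> 1 / (1 - q)" using q by (simp add: suminf_geometric)
  qed auto
  finally show ?thesis by (simp add: Y_def q_def)
qed

text \<open>As \<open>s \<le> 4\<epsilon> \<le> 1\<close>, the power is at most \<open>s^3\<close>:
  one factor supplies \<open>\<epsilon>\<close>, the other two supply the squares.\<close>

lemma cubic_deviation_le:
  fixes a b \<epsilon> :: real
  assumes "k \<ge> 3" and "\<bar>a\<bar> \<le> \<epsilon>" "\<bar>b\<bar> \<le> \<epsilon>" and "\<epsilon> \<le> 1 / 4"
    and s: "s = \<bar>- (a + b)\<bar> + \<bar>a\<bar> + \<bar>b\<bar>"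
  shows "s ^ k \<le> 32 * \<epsilon> * (a\<^sup>2 + b\<^sup>2)"
proof -
  have s0: "0 \<le> s" "s \<le> 2 * (\<bar>a\<bar> + \<bar>b\<bar>)"
    using abs_triangle_ineq[of a b] by (auto simp: s)
  then have s1: "s \<le> 4 * \<epsilon>" using assms by linarith
  have "s ^ k \<le> s ^ 3" using s0 s1 assms by (intro power_decreasing) auto
  also have "\<dots> = s * s\<^sup>2" by (simp add: eval_nat_numeral)
  also have "\<dots> \<le> (4 * \<epsilon>) * (2 * (\<bar>a\<bar> + \<bar>b\<bar>))\<^sup>2"
    using s0 s1 by (intro mult_mono power_mono) auto
  also have "(2 * (\<bar>a\<bar> + \<bar>b\<bar>))\<^sup>2 \<le> 8 * (a\<^sup>2 + b\<^sup>2)"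
    using sum_squares_bound[of "\<bar>a\<bar>" "\<bar>b\<bar>"] by (simp add: power2_sum power_mult_distrib)
  then have "(4 * \<epsilon>) * (2 * (\<bar>a\<bar> + \<bar>b\<bar>))\<^sup>2 \<le> (4 * \<epsilon>) * (8 * (a\<^sup>2 + b\<^sup>2))"
    using assms by (intro mult_left_mono) auto
  finally show ?thesis by (simp add: algebra_simps)
qed

text \<open>The bound on \<open>K\<close> turns \<open>N\<close> into a summand of
  \<open>colourings\<close> times \<open>exp (2 m s^k)\<close>, and this exponential is split so
  that each term involves one coordinate of \<open>l\<close> only.\<close>

lemma N_le_colourings_summand:
  assumes k: "k \<ge> 3" and m: "0 < m" "m \<le> n" "2 * n \<le> k * m"
    and \<epsilon>: "\<epsilon> \<le> 1 / 12"
    and l: "l \<in> compositions3 (k * m)" "\<bar>real (l 1) / real (k * m) - 1 / 3\<bar> \<le> \<epsilon>"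
      "\<bar>real (l 2) / real (k * m) - 1 / 3\<bar> \<le> \<epsilon>"
  shows "N k m w l \<le> 2 * 6 ^ k * exp 3 * real k / 3 ^ m *
    (multinom {..<3} w * multinom {..<3} l * (\<Prod>i<3. M (l i) (w i))) *
    (\<Sum>i\<in>{1, 2}. exp (64 * \<epsilon> * (real (l i) - real (k * m) / 3)\<^sup>2 / real n))"
proof -
  define z where "z i = real (l i) / real (k * m)" for i
  define a where "a i = z i - 1 / 3" for i
  define s where "s = (\<Sum>i<3. \<bar>z i - 1 / 3\<bar>)"
  define y where "y i = (real (l i) - real (k * m) / 3)\<^sup>2 / real n" for i
  define G where "G = (\<Prod>i<3. M (l i) (w i))"
  have km: "real (k * m) > 0" using k m by simp
  have \<epsilon>0: "0 \<le> \<epsilon>" using l(2) by linarith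
  have n: "real n > 0" using m by simp
  have sum: "z 0 + z 1 + z 2 = 1"
    using k m compositions3_sum[OF l(1)] unfolding z_def
    by (simp add: add_divide_distrib[symmetric] flip: of_nat_add of_nat_mult)
  have a: "\<bar>a 1\<bar> \<le> \<epsilon>" "\<bar>a 2\<bar> \<le> \<epsilon>" using l(2,3) by (simp_all only: a_def z_def)
  have a0: "a 0 = - (a 1 + a 2)" using sum by (simp add: a_def)
  have z_ge: "1 / 6 \<le> z i" if "i < 3" for i
  proof -
    have "i = 0 \<or> i = 1 \<or> i = 2" using that by auto
    then show ?thesis using a \<epsilon> sum unfolding a_def by (auto simp: abs_le_iff)
  qed
  have s: "s = \<bar>- (a 1 + a 2)\<bar> + \<bar>a 1\<bar> + \<bar>a 2\<bar>"
    using a0 by (simp add: s_def sum_lessThan_3 a_def)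
  have "s ^ k \<le> 32 * \<epsilon> * ((a 1)\<^sup>2 + (a 2)\<^sup>2)"
    using \<epsilon> by (intro cubic_deviation_le[OF k a _ s]) auto
  then have "2 * real m * s ^ k \<le> 2 * real m * (32 * \<epsilon> * ((a 1)\<^sup>2 + (a 2)\<^sup>2))"
    by (intro mult_left_mono) auto
  also have "\<dots> = 64 * \<epsilon> * (real m * (a 1)\<^sup>2) + 64 * \<epsilon> * (real m * (a 2)\<^sup>2)"
    by (simp add: algebra_simps)
  also have "\<dots> \<le> 64 * \<epsilon> * (y 1 / 2) + 64 * \<epsilon> * (y 2 / 2)"
  proof (intro add_mono mult_left_mono)
    have "real m * (a i)\<^sup>2 \<le> y i / 2" for i
    proof -
      have "real m * (a i)\<^sup>2 = (real m / (real (k * m))\<^sup>2) * (real (k * m) * a i)\<^sup>2"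
        using k m by (simp add: power_mult_distrib)
      also have "real (k * m) * a i = real (l i) - real (k * m) / 3"
        using k m by (simp add: a_def z_def right_diff_distrib)
      also have "real m / (real (k * m))\<^sup>2 \<le> 1 / (2 * real n)"
      proof -
        have "2 * n * m \<le> k * m * (k * m)"
          by (rule mult_mono[OF m(3)]) (use k in auto)
        then have "real (2 * n * m) \<le> real (k * m * (k * m))" by (rule of_nat_mono)
        then have "real m * (2 * real n) \<le> (real (k * m))\<^sup>2"
          by (simp add: power2_eq_square ac_simps)
        then have "real m \<le> 1 / (2 * real n) * (real (k * m))\<^sup>2"
          using n by (simp add: pos_le_divide_eq del: of_nat_mult)
        then show ?thesis using zero_less_power[OF km, of 2] by (simp only: pos_divide_le_eq)
      qed
      then have "real m / (real (k * m))\<^sup>2 * (real (l i) - real (k * m) / 3)\<^sup>2 \<le> 1 / (2 * real n) * (real (l i) - real (k * m) / 3)\<^sup>2"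
        by (intro mult_right_mono) auto
      finally show ?thesis by (simp add: y_def)
    qed
    then show "real m * (a 1)\<^sup>2 \<le> y 1 / 2" "real m * (a 2)\<^sup>2 \<le> y 2 / 2" by auto
  qed (use \<epsilon>0 in auto)
  \<comment> \<open>An average is at most the maximum, whose exponential is at most the sum of the
    two exponentials; no joint control of \<open>l 1\<close> and \<open>l 2\<close> is
    required.\<close>
  also have "\<dots> \<le> max (64 * \<epsilon> * y 1) (64 * \<epsilon> * y 2)" by simp
  finally have "exp (2 * real m * s ^ k) \<le> exp (max (64 * \<epsilon> * y 1) (64 * \<epsilon> * y 2))" by simp
  also have "\<dots> \<le> exp (64 * \<epsilon> * y 1) + exp (64 * \<epsilon> * y 2)" by (simp add: max_def add_increasing add_increasing2)
  finally have e: "exp (2 * real m * s ^ k) \<le> (\<Sum>i\<in>{1, 2}. exp (64 * \<epsilon> * y i))" by simp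
  have G: "0 \<le> G" unfolding G_def by (intro prod_nonneg M_nonneg)
  have "K k m l \<le> 2 * 6 ^ k * exp 3 * real k * multinom {..<3} l * exp (2 * real m * s ^ k) / 3 ^ m"
    using z_ge by (intro K_le_multinom k m l(1)) (auto simp: s_def z_def)
  then have "N k m w l \<le> multinom {..<3} w * (2 * 6 ^ k * exp 3 * real k * multinom {..<3} l * exp (2 * real m * s ^ k) / 3 ^ m) * G"
    unfolding N_def G_def[symmetric] using G less_imp_le[OF multinom_pos[of w]]
    by (intro mult_right_mono mult_left_mono)
  also have "\<dots> = 2 * 6 ^ k * exp 3 * real k / 3 ^ m * (multinom {..<3} w * multinom {..<3} l * G) * exp (2 * real m * s ^ k)"
    by simp
  also have "\<dots> \<le> 2 * 6 ^ k * exp 3 * real k / 3 ^ m * (multinom {..<3} w * multinom {..<3} l * G) * (\<Sum>i\<in>{1, 2}. exp (64 * \<epsilon> * y i))"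
    using G less_imp_le[OF multinom_pos] by (intro mult_left_mono e mult_nonneg_nonneg) auto
  finally show ?thesis by (simp only: G_def y_def times_divide_eq_right)
qed

text \<open>Here \<open>r = 2k\<close> bounds the load \<open>km / (n-1)\<close>. The constant
  \<open>2048 = 32 * 64\<close> gives \<open>32 exp (e^2 r) \<eta> = 1/k\<close>, and the factor
  \<open>1/k\<close> in \<open>\<epsilon>\<close> keeps the relative range
  \<open>\<delta> = k\<epsilon>\<close> of the deviations small.\<close>

lemma sum_central_le:
  fixes k n m :: nat
  defines "r \<equiv> 2 * real k"
  defines "\<epsilon> \<equiv> 1 / (2048 * exp (exp 2 * r) * real k)"
  defines "\<eta> \<equiv> 64 * \<epsilon>"
  assumes k: "k \<ge> 3" and m: "0 < m" "m < n" "2 * n \<le> k * m"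
  shows "(\<Sum>(w, l)\<in>central k m n \<epsilon>. N k m w l)
    \<le> 2 * 6 ^ k * exp 3 * real k / 3 ^ m * (2 * (exp \<eta> * (2 / (1 - exp (- \<eta> / 2))))) * 3 ^ n * M (k * m) n"
proof -
  define C where "C = 2 * 6 ^ k * exp 3 * real k / 3 ^ m"
  define B where "B = exp (exp 2 * r)"
  define L where "L = {l \<in> compositions3 (k * m). \<bar>real (l 1) / real (k * m) - 1 / 3\<bar> \<le> \<epsilon> \<and> \<bar>real (l 2) / real (k * m) - 1 / 3\<bar> \<le> \<epsilon>}"
  define W where "W w l = multinom {..<3} w * multinom {..<3} l * (\<Prod>i<3. M (l i) (w i))" for w l :: "nat \<Rightarrow> nat"
  define E where "E i l = exp (\<eta> * (real (l i) - real (k * m) / 3)\<^sup>2 / real n)" for i :: nat and l :: "nat \<Rightarrow> nat"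
  have B: "1 \<le> B" by (simp add: B_def r_def)
  have "0 < \<epsilon>" using k by (simp add: \<epsilon>_def)
  have Bk: "2048 * B * real k * \<epsilon> = 1" using k B by (simp add: \<epsilon>_def B_def)
  have "1 * 3 \<le> B * real k" using B k by (intro mult_mono) auto
  then have "3 * \<epsilon> \<le> B * real k * \<epsilon>" using \<open>0 < \<epsilon>\<close> by (intro mult_right_mono) auto
  then have \<epsilon>: "0 < \<epsilon>" "\<epsilon> \<le> 1 / 2048" using Bk \<open>0 < \<epsilon>\<close> by linarith+
  have "1 * (real k * \<epsilon>) \<le> B * (real k * \<epsilon>)" using B \<epsilon> by (intro mult_right_mono) auto
  then have k\<epsilon>: "real k * \<epsilon> \<le> 1 / 2048" using Bk by (simp add: mult.assoc)
  have "B * \<epsilon> * 1 \<le> B * \<epsilon> * real k" using B \<epsilon> k by (intro mult_left_mono) auto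
  also have "\<dots> = B * real k * \<epsilon>" by simp
  finally have B\<epsilon>: "B * \<epsilon> \<le> 1 / 2048" using Bk by linarith
  have W0: "0 \<le> W w l" for w l
    unfolding W_def by (intro mult_nonneg_nonneg prod_nonneg M_nonneg less_imp_le[OF multinom_pos])
  have N0: "0 \<le> C" by (simp add: C_def)
  have fin: "finite L" unfolding L_def using finite_compositions3 by simp
  have sub: "central k m n \<epsilon> \<subseteq> compositions3 n \<times> L"
    by (auto simp: central_def U_def L_def)
  have "(\<Sum>(w, l)\<in>central k m n \<epsilon>. N k m w l) \<le> (\<Sum>(w, l)\<in>central k m n \<epsilon>. C * W w l * (\<Sum>i\<in>{1, 2}. E i l))"
  proof (intro sum_mono, clarify)
    fix w l assume "(w, l) \<in> central k m n \<epsilon>"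
    with sub have "l \<in> L" by auto
    then show "N k m w l \<le> C * W w l * (\<Sum>i\<in>{1, 2}. E i l)"
      unfolding C_def W_def E_def \<eta>_def using k m \<epsilon>
      by (intro N_le_colourings_summand) (auto simp: L_def)
  qed
  also have "\<dots> \<le> (\<Sum>(w, l)\<in>compositions3 n \<times> L. C * W w l * (\<Sum>i\<in>{1, 2}. E i l))"
    using sub W0 N0 by (intro sum_mono2) (auto simp: fin finite_compositions3 E_def intro!: mult_nonneg_nonneg add_nonneg_nonneg)
  also have "\<dots> = (\<Sum>w\<in>compositions3 n. \<Sum>l\<in>L. C * W w l * (\<Sum>i\<in>{1, 2}. E i l))"
    by (rule sum.cartesian_product[symmetric])
  also have "\<dots> = (\<Sum>l\<in>L. \<Sum>w\<in>compositions3 n. C * W w l * (\<Sum>i\<in>{1, 2}. E i l))"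
    by (rule sum.swap)
  also have "\<dots> = (\<Sum>l\<in>L. C * colourings n l * (\<Sum>i\<in>{1, 2}. E i l))"
  proof -
    have "(\<Sum>w\<in>compositions3 n. C * W w l * x) = C * colourings n l * x" for l x
      by (simp add: colourings_def W_def sum_distrib_left sum_distrib_right)
    then show ?thesis by (simp only:)
  qed
  also have "\<dots> = C * (\<Sum>i\<in>{1, 2}. \<Sum>l\<in>L. colourings n l * E i l)"
    by (simp add: sum_distrib_left distrib_left sum.distrib ac_simps)
  also have "\<dots> \<le> C * (\<Sum>i\<in>{1::nat, 2}. exp \<eta> * (2 / (1 - exp (- \<eta> / 2))) * 3 ^ n * M (k * m) n)"
  proof (intro mult_left_mono sum_mono N0)
    fix i :: nat assume i: "i \<in> {1, 2}"
    show "(\<Sum>l\<in>L. colourings n l * E i l) \<le> exp \<eta> * (2 / (1 - exp (- \<eta> / 2))) * 3 ^ n * M (k * m) n"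
      unfolding E_def
    proof (rule sum_colourings_gauss_le[where r = r and \<delta> = "real k * \<epsilon>"])
      show "2 \<le> n" "i < 3" using m i by auto
      have "k * m \<le> k * (2 * (n - 1))" using m by (intro mult_left_mono) auto
      then have "real (k * m) \<le> real (k * (2 * (n - 1)))" by (rule of_nat_mono)
      then show "real (k * m) \<le> r * real (n - 1)" by (simp add: r_def ac_simps)
      show "1 \<le> r" "0 < \<eta>" using k \<epsilon> by (auto simp: r_def \<eta>_def)
      show "32 * exp (exp 2 * r) * \<eta> \<le> 1" using B\<epsilon> by (simp add: \<eta>_def B_def)
      have "\<eta> * (real k * \<epsilon>) \<le> 1 / 2 * 1"
        using \<epsilon> k\<epsilon> by (intro mult_mono) (auto simp: \<eta>_def)
      then show "2 * \<eta> * (real k * \<epsilon>) \<le> 1" by simp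
      show "L \<subseteq> compositions3 (k * m)" by (auto simp: L_def)
    next
      fix l assume "l \<in> L"
      then have "\<bar>real (l i) / real (k * m) - 1 / 3\<bar> \<le> \<epsilon>" using i by (auto simp: L_def)
      then have "real (k * m) * \<bar>real (l i) / real (k * m) - 1 / 3\<bar> \<le> real (k * m) * \<epsilon>"
        by (intro mult_left_mono) auto
      also have "real (k * m) * \<bar>real (l i) / real (k * m) - 1 / 3\<bar> = \<bar>real (l i) - real (k * m) / 3\<bar>"
      proof -
        have "real (k * m) * \<bar>real (l i) / real (k * m) - 1 / 3\<bar> = \<bar>real (k * m) * (real (l i) / real (k * m) - 1 / 3)\<bar>"
          by (simp add: abs_mult)
        also have "real (k * m) * (real (l i) / real (k * m) - 1 / 3) = real (l i) - real (k * m) / 3"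
          using k m by (simp add: right_diff_distrib)
        finally show ?thesis .
      qed
      also have "real (k * m) * \<epsilon> \<le> real k * \<epsilon> * real n"
        using m \<epsilon> by (simp add: mult_left_mono mult.assoc mult.left_commute[of "real m"])
      finally show "\<bar>real (l i) - real (k * m) / 3\<bar> \<le> real k * \<epsilon> * real n" .
    qed
  qed
  finally show ?thesis by (simp add: C_def)
qed

theorem theorem6:
  fixes k :: nat and \<gamma> :: "nat \<Rightarrow> real" and c :: real
  assumes "k \<ge> 3"
    and "c < 1"
    and "\<And>n. \<gamma> n \<le> c"
    and "\<And>n. real k * \<gamma> n > 2"
  shows "\<exists>\<epsilon>>0. \<exists>C::real. \<forall>n m :: nat. n \<ge> 1 \<longrightarrow> real m = \<gamma> n * real n \<longrightarrow>
           (\<Sum>(w, l)\<in>central k m n \<epsilon>. N k m w l / N0 k m n)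
             < C * 3 powr ((1 - \<gamma> n) * real n)"
proof -
  define \<epsilon> where "\<epsilon> = 1 / (2048 * exp (exp 2 * (2 * real k)) * real k)"
  define \<eta> where "\<eta> = 64 * \<epsilon>"
  define D where "D = 2 * 6 ^ k * exp 3 * real k * (2 * (exp \<eta> * (2 / (1 - exp (- \<eta> / 2)))))"
  have \<epsilon>: "0 < \<epsilon>" using assms(1) by (simp add: \<epsilon>_def)
  then have D: "0 \<le> D" by (simp add: D_def \<eta>_def)
  \<comment> \<open>\<open>D + 1\<close> in place of \<open>D\<close> makes the inequality
    strict.\<close>
  have "(\<Sum>(w, l)\<in>central k m n \<epsilon>. N k m w l / N0 k m n) < (D + 1) * 3 powr ((1 - \<gamma> n) * real n)"
    if n: "n \<ge> 1" and m: "real m = \<gamma> n * real n" for n m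
  proof -
    have \<gamma>: "2 < real k * \<gamma> n" "\<gamma> n < 1" using assms(2) assms(3)[of n] assms(4)[of n] by auto
    have "2 * real n < real k * \<gamma> n * real n" using \<gamma> n by (intro mult_strict_right_mono) auto
    then have "real (2 * n) < real (k * m)" by (simp add: m mult.assoc)
    then have km: "2 * n < k * m" by (simp only: of_nat_less_iff)
    then have m0: "0 < m" using n by (cases m) auto
    have "\<gamma> n * real n < 1 * real n" using \<gamma> n by (intro mult_strict_right_mono) auto
    then have mn: "m < n" using m by simp
    have "(\<Sum>(w, l)\<in>central k m n \<epsilon>. N k m w l / N0 k m n) = (\<Sum>(w, l)\<in>central k m n \<epsilon>. N k m w l) / N0 k m n"
      by (simp add: sum_divide_distrib case_prod_unfold)
    also have "\<dots> \<le> (D * (3 ^ n / 3 ^ m) * N0 k m n) / N0 k m n"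
    proof (rule divide_right_mono)
      show "(\<Sum>(w, l)\<in>central k m n \<epsilon>. N k m w l) \<le> D * (3 ^ n / 3 ^ m) * N0 k m n"
        using sum_central_le[OF assms(1) m0 mn less_imp_le[OF km], folded \<epsilon>_def, folded \<eta>_def]
        by (simp add: D_def N0_def ac_simps)
    qed (simp add: N0_def M_nonneg)
    \<comment> \<open>If \<open>N0\<close> were 0, the quotient would be 0 by convention and the
      bound would persist.\<close>
    also have "\<dots> \<le> D * (3 ^ n / 3 ^ m)" using D by simp
    also have "(3 ^ n / 3 ^ m :: real) = 3 powr ((1 - \<gamma> n) * real n)"
      by (simp add: left_diff_distrib powr_diff powr_realpow m[symmetric])
    also have "D * 3 powr ((1 - \<gamma> n) * real n) < (D + 1) * 3 powr ((1 - \<gamma> n) * real n)"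
      by simp
    finally show ?thesis .
  qed
  with \<epsilon> show ?thesis by blast
qed

end
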